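(* Let $p$ be a probability density on $\mathbb R^d$ and let $x\in\mathrm{supp}(p)$. Suppose that $p$ is locally $(\sigma,S)$-Hölder continuous at $x$ for some $\sigma\in(0,2]$ and $S>0$. Then for any fixed integer $k\ge3$, with truncation levels $\tau_n=0$ and $\nu_n=\Theta((\log n)^{1+\varepsilon})$ for some $\varepsilon>0$, and with $\zeta=\min\{\frac\sigma d,1\}$, $$\mathbb E_{\mathbf X_{1:M}}\bigl[(\tilde p_{k,M}(x;\mathbf X_{1:M})-p(x))^2\bigr]=\tilde O(n^{-2\zeta}+M^{-1}).$$
   Context: $N=Mn$ i.i.d. samples from $p$ are split into $M$ disjoint subsets $\mathbf X_1,\dots,\mathbf X_M$ of size $n$; $\mathbf X_{1:M}=\{\mathbf X_1,\dots,\mathbf X_M\}$. For a sample $\mathbf X$ of size $n$, $U_k(x;\mathbf X)=n\lambda(B^o(x,r_k(x;\mathbf X)))$, where $\lambda$ is Lebesgue measure, $r_k(x;\mathbf X)$ is the Euclidean distance from $x$ to its $k$-th nearest neighbor in $\mathbf X$, and $B^o(x,r)$ is the open Euclidean ball. The truncated $k$-NN density estimator is $\tilde p_k(x;\mathbf X)=\frac{k-1}{U_k(x;\mathbf X)}\mathbf 1_{(\tau_n,\nu_n)}(U_k(x;\mathbf X))$, and $\tilde p_{k,M}(x;\mathbf X_{1:M})=\frac1M\sum_{m=1}^M\tilde p_k(x;\mathbf X_m)$. For $\sigma,S>0$, a function $h:\mathbb R^d\to\mathbb R$ is $(\sigma,S)$-Hölder continuous over an open set $\Omega$ if it is continuously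 differentiable on $\Omega$ up to order $\kappa=\lceil\sigma\rceil-1$ and $|\partial^{\mathbf r}h(y)-\partial^{\mathbf r}h(z)|\le S\|y-z\|^{\sigma-\kappa}$ for all multi-indices $\mathbf r$ with $|\mathbf r|=\kappa$ and all $y\neq z$ in $\Omega$. It is locally $(\sigma,S)$-Hölder continuous at $x$ if this holds on some open neighborhood of $x$. $\tilde O(\cdot)$ is as $n\to\infty$, for fixed $x,p,k$ and uniformly in $M\ge1$, and hides polylogarithmic factors. *)

theory Defs
  imports "HOL-Probability.Probability" "HOL-Library.Landau_Symbols"
begin

definition partial_deriv :: "'d::finite \<Rightarrow> (real ^ 'd \<Rightarrow> real) \<Rightarrow> real ^ 'd \<Rightarrow> real" where
  "partial_deriv i h x = deriv (\<lambda>t. h (x + t *\<^sub>R axis i 1)) 0"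

primrec iter_partial :: "'d::finite list \<Rightarrow> (real ^ 'd \<Rightarrow> real) \<Rightarrow> real ^ 'd \<Rightarrow> real" where
  "iter_partial [] h = h"
| "iter_partial (i # js) h = partial_deriv i (iter_partial js h)"

text \<open>Meant for open \<open>\<Omega>\<close>: all partial derivatives of order up to \<open>m\<close> exist and are
  continuous on \<open>\<Omega>\<close>.\<close>

definition cont_diff_on :: "nat \<Rightarrow> (real ^ 'd::finite) set \<Rightarrow> (real ^ 'd \<Rightarrow> real) \<Rightarrow> bool" where
  "cont_diff_on m \<Omega> h \<longleftrightarrow>
     (\<forall>js i. length js < m \<longrightarrow>
        (\<forall>x\<in>\<Omega>. (\<lambda>t. iter_partial js h (x + t *\<^sub>R axis i 1)) field_differentiable (at 0))) \<and>
     (\<forall>js. length js \<le> m \<longrightarrow> continuous_on \<Omega> (iter_partial js h))"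

text \<open>A multi-index is a function \<open>r\<close>; \<open>r i\<close> is the order of differentiation in coordinate \<open>i\<close>.
  The directions are taken in an arbitrary order, which is immaterial whenever \<open>h\<close> is
  continuously differentiable up to order \<open>\<Sum>i. r i\<close>.\<close>

definition multi_partial :: "('d::finite \<Rightarrow> nat) \<Rightarrow> (real ^ 'd \<Rightarrow> real) \<Rightarrow> real ^ 'd \<Rightarrow> real" where
  "multi_partial r h = iter_partial (SOME js. count_list js = r) h"

definition holder_on ::
    "real \<Rightarrow> real \<Rightarrow> (real ^ 'd::finite) set \<Rightarrow> (real ^ 'd \<Rightarrow> real) \<Rightarrow> bool" where
  "holder_on \<sigma> S \<Omega> h \<longleftrightarrow>
     (let \<kappa> = nat (\<lceil>\<sigma>\<rceil> - 1) in
        cont_diff_on \<kappa> \<Omega> h \<and>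
        (\<forall>r. (\<Sum>i\<in>UNIV. r i) = \<kappa> \<longrightarrow>
           (\<forall>y\<in>\<Omega>. \<forall>z\<in>\<Omega>. y \<noteq> z \<longrightarrow>
              \<bar>multi_partial r h y - multi_partial r h z\<bar> \<le> S * norm (y - z) powr (\<sigma> - real \<kappa>))))"

definition locally_holder_at ::
    "real \<Rightarrow> real \<Rightarrow> (real ^ 'd::finite \<Rightarrow> real) \<Rightarrow> real ^ 'd \<Rightarrow> bool" where
  "locally_holder_at \<sigma> S h x \<longleftrightarrow> (\<exists>\<Omega>. open \<Omega> \<and> x \<in> \<Omega> \<and> holder_on \<sigma> S \<Omega> h)"

definition prob_density :: "(real ^ 'd::finite \<Rightarrow> real) \<Rightarrow> bool" where
  "prob_density p \<longleftrightarrow>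
     p \<in> borel_measurable borel \<and> (\<forall>y. 0 \<le> p y) \<and> (\<integral>\<^sup>+ y. ennreal (p y) \<partial>lborel) = 1"

definition supp :: "(real ^ 'd::finite \<Rightarrow> real) \<Rightarrow> (real ^ 'd) set" where
  "supp p = closure {y. p y \<noteq> 0}"

definition iid_samples :: "nat \<Rightarrow> (real ^ 'd::finite \<Rightarrow> real) \<Rightarrow> (nat \<Rightarrow> real ^ 'd) measure" where
  "iid_samples N p = (\<Pi>\<^sub>M i\<in>{..<N}. density lborel (\<lambda>y. ennreal (p y)))"

text \<open>A sample of size \<open>n\<close> is given by the values \<open>X 0, \<dots>, X (n - 1)\<close>. The distance to the
  \<open>k\<close>-th nearest neighbor is the \<open>k\<close>-th smallest distance, counted with multiplicity; it is
  meaningful only for \<open>1 \<le> k \<le> n\<close>.\<close>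

definition knn_dist :: "nat \<Rightarrow> nat \<Rightarrow> (nat \<Rightarrow> real ^ 'd::finite) \<Rightarrow> real ^ 'd \<Rightarrow> real" where
  "knn_dist k n X x = sort (map (\<lambda>i. dist x (X i)) [0..<n]) ! (k - 1)"

definition knn_volume :: "nat \<Rightarrow> nat \<Rightarrow> (nat \<Rightarrow> real ^ 'd::finite) \<Rightarrow> real ^ 'd \<Rightarrow> real" where
  "knn_volume k n X x = real n * measure lborel (ball x (knn_dist k n X x))"

definition trunc_knn_density ::
    "nat \<Rightarrow> real \<Rightarrow> real \<Rightarrow> nat \<Rightarrow> (nat \<Rightarrow> real ^ 'd::finite) \<Rightarrow> real ^ 'd \<Rightarrow> real" where
  "trunc_knn_density k \<tau> \<nu> n X x =
     (real k - 1) / knn_volume k n X x * indicator {\<tau><..<\<nu>} (knn_volume k n X x)"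

text \<open>The \<open>M * n\<close> samples are split into \<open>M\<close> consecutive blocks of size \<open>n\<close>.\<close>

definition split_knn_density ::
    "nat \<Rightarrow> real \<Rightarrow> real \<Rightarrow> nat \<Rightarrow> nat \<Rightarrow> (nat \<Rightarrow> real ^ 'd::finite) \<Rightarrow> real ^ 'd \<Rightarrow> real" where
  "split_knn_density k \<tau> \<nu> M n X x =
     1 / real M * (\<Sum>m<M. trunc_knn_density k \<tau> \<nu> n (\<lambda>i. X (m * n + i)) x)"

text \<open>Asymptotics as \<open>n \<rightarrow> \<infinity>\<close>, uniformly in \<open>M \<ge> 1\<close>: the constant, the threshold for \<open>n\<close> and
  the exponent of the logarithm do not depend on \<open>M\<close>.\<close>

definition soft_O_unif :: "(nat \<Rightarrow> nat \<Rightarrow> real) \<Rightarrow> (nat \<Rightarrow> nat \<Rightarrow> real) set" where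
  "soft_O_unif g =
     {f. \<exists>a::nat. (\<lambda>(n, M). f n M) \<in>
        O[sequentially \<times>\<^sub>F principal {1..}](\<lambda>(n, M). ln (real n) ^ a * g n M)}"

end

theory Submission
  imports Defs "HOL-Real_Asymp.Real_Asymp"
begin

text \<open>
  Let \<open>U\<close> be the normalised \<open>k\<close>-nearest-neighbour volume of one block of \<open>n\<close> samples and \<open>q t\<close> the
  \<open>p\<close>-mass of the ball around \<open>x\<close> of volume \<open>t / n\<close>. Then \<open>U < t\<close> holds iff at least \<open>k\<close> samples fall
  into this ball, so the distribution function of \<open>U\<close> is the binomial tail of \<open>q t\<close>, and the first
  two moments of \<open>1 / U\<close> truncated at \<open>\<nu>\<close> are layer-cake integrals of it. Hoelder regularity gives
  \<open>q t = p x * t / n + O((t / n) powr (1 + \<sigma> / d))\<close>; for \<open>\<sigma> > 1\<close> the linear term of the expansion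
  cancels by symmetry of the ball. With \<open>q t\<close> replaced by its main term the layer-cake integral is
  explicit: it gives exactly \<open>p x\<close> times a binomial tail, which (if \<open>p x > 0\<close>) is superpolynomially
  close to \<open>1\<close> by the growth of \<open>\<nu>\<close>. So the bias of one block is \<open>n powr (- \<zeta>)\<close> and its second moment is
  bounded, both up to logarithms, and averaging \<open>M\<close> independent blocks divides the variance by \<open>M\<close>.
\<close>

section \<open>Binomial tails\<close>

text \<open>For \<open>q\<close> in \<open>[0, 1]\<close> this is the probability that a binomial
  variable with \<open>n\<close> trials and success probability \<open>q\<close> is at least
  \<open>k\<close>. As a polynomial in \<open>q\<close> it can be differentiated directly.\<close>

definition binom_tail :: "nat \<Rightarrow> nat \<Rightarrow> real \<Rightarrow> real" where
  "binom_tail n k q = (\<Sum>j=k..n. real (n choose j) * q ^ j * (1 - q) ^ (n - j))"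

lemma binomial_le_power: "n choose j \<le> n ^ j"
  by (cases "j \<le> n") (auto simp: binomial_le_pow not_le binomial_eq_0)

lemma binom_tail_0: "binom_tail n 0 q = 1"
  using binomial_ring[of q "1 - q" n] by (simp add: binom_tail_def atLeast0AtMost)

lemma binom_tail_zero: "0 < k \<Longrightarrow> binom_tail n k 0 = 0"
  by (auto simp: binom_tail_def power_0_left intro!: sum.neutral)

lemma binom_tail_nonneg: "0 \<le> q \<Longrightarrow> q \<le> 1 \<Longrightarrow> 0 \<le> binom_tail n k q"
  by (auto simp: binom_tail_def intro!: sum_nonneg)

lemma binom_tail_Suc:
  "k \<le> n \<Longrightarrow> binom_tail n k q = real (n choose k) * q ^ k * (1 - q) ^ (n - k) + binom_tail n (Suc k) q"
  by (simp add: binom_tail_def sum.atLeast_Suc_atMost)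

text \<open>Downward induction on \<open>k\<close>, starting from the empty sum
  \<open>k > n\<close>: the derivative of the first summand has two terms, and the negative one
  cancels the derivative of the remaining tail. What is left is the density of the
  \<open>k\<close>-th smallest of \<open>n\<close> uniform variables on
  \<open>[0, 1]\<close>.\<close>

lemma has_field_derivative_binom_tail:
  assumes "0 < k" "0 < n"
  shows "(binom_tail n k has_field_derivative
    real n * real ((n - 1) choose (k - 1)) * q ^ (k - 1) * (1 - q) ^ (n - k)) (at q within A)"
  using assms(1)
proof (induction "Suc n - k" arbitrary: k)
  case 0
  then have *: "binom_tail n k = (\<lambda>_. 0)" and "n - 1 < k - 1"
    using assms by (auto simp: binom_tail_def fun_eq_iff)
  then have "(n - 1) choose (k - 1) = 0" by (intro binomial_eq_0)
  then show ?case unfolding * by (metis DERIV_const mult_zero_left mult_zero_right of_nat_0)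
next
  case (Suc m)
  then have k: "k \<le> n" "m = Suc n - Suc k" by auto
  have c1: "real k * real (n choose k) = real n * real ((n - 1) choose (k - 1))"
    using Suc.prems by (simp add: binomial_absorption flip: of_nat_mult)
      (metis One_nat_def Suc_pred' assms(2) Suc_times_binomial_eq mult.commute)
  have c2: "real (n - k) * real (n choose k) = real n * real ((n - 1) choose k)"
    using binomial_absorb_comp[of n k] by (metis of_nat_mult)
  have e: "binom_tail n k = (\<lambda>q. real (n choose k) * q ^ k * (1 - q) ^ (n - k) + binom_tail n (Suc k) q)"
    using k binom_tail_Suc by blast
  have IH: "(binom_tail n (Suc k) has_field_derivative
     real n * real ((n - 1) choose k) * q ^ k * (1 - q) ^ (n - Suc k)) (at q within A)"
    using Suc.hyps(1)[OF k(2)] by simp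
  let ?X = "q ^ (k - 1) * (1 - q) ^ (n - k)" and ?Y = "q ^ k * (1 - q) ^ (n - Suc k)"
  have "(binom_tail n k has_field_derivative
      (real k * real (n choose k)) * ?X - (real (n - k) * real (n choose k)) * ?Y
      + real n * real ((n - 1) choose k) * ?Y) (at q within A)"
    unfolding e by (rule derivative_eq_intros IH refl)+ (simp add: algebra_simps)
  then show ?case unfolding c1 c2 by (simp add: mult.assoc)
qed

text \<open>Mean value bound with the derivative estimated on \<open>{0..c}\<close> only. Keeping
  \<open>c\<close> instead of \<open>1\<close> preserves a factor \<open>c ^ (k - 1)\<close>, which
  later absorbs the singularity of \<open>1 / t\<^sup>2\<close> at \<open>0\<close>.\<close>

lemma binom_tail_lipschitz:
  assumes "0 < k" "0 \<le> a" "a \<le> c" "0 \<le> b" "b \<le> c" "c \<le> 1"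
  shows "\<bar>binom_tail n k a - binom_tail n k b\<bar> \<le> real n * (real n * c) ^ (k - 1) * \<bar>a - b\<bar>"
proof (cases "n = 0")
  case True
  then show ?thesis using assms by (simp add: binom_tail_def)
next
  case False
  show ?thesis
  proof (rule field_differentiable_bound[of "{0..c}" "binom_tail n k", unfolded real_norm_def])
    fix z assume z: "z \<in> {0..c}"
    have ch: "real ((n - 1) choose (k - 1)) \<le> real (n ^ (k - 1))"
      unfolding of_nat_le_iff
      by (rule order_trans[OF binomial_le_power]) (simp add: power_mono)
    have "real ((n - 1) choose (k - 1)) * (z ^ (k - 1) * (1 - z) ^ (n - k)) \<le> real n ^ (k - 1) * (c ^ (k - 1) * 1)"
      using z assms ch by (intro mult_mono power_mono power_le_one) auto
    then show "\<bar>real n * real ((n - 1) choose (k - 1)) * z ^ (k - 1) * (1 - z) ^ (n - k)\<bar>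
       \<le> real n * (real n * c) ^ (k - 1)"
      using z assms by (simp add: abs_mult power_mult_distrib mult_left_mono mult.assoc)
    show "(binom_tail n k has_field_derivative
      real n * real ((n - 1) choose (k - 1)) * z ^ (k - 1) * (1 - z) ^ (n - k)) (at z within {0..c})"
      using assms False by (intro has_field_derivative_binom_tail) auto
  qed (use assms in auto)
qed

text \<open>The Lipschitz bound with \<open>c = q\<close>, compared with the point \<open>0\<close>,
  where the tail vanishes.\<close>

lemma binom_tail_le:
  assumes "0 < k" "0 \<le> q" "q \<le> 1"
  shows "binom_tail n k q \<le> (real n * q) ^ k"
  using binom_tail_lipschitz[of k q q 0 n] assms
  by (cases k) (auto simp: binom_tail_zero abs_le_iff algebra_simps)

lemma continuous_on_binom_tail: "continuous_on A (binom_tail n k)"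
  unfolding binom_tail_def by (intro continuous_intros)

lemma borel_measurable_binom_tail [measurable]: "binom_tail n k \<in> borel_measurable borel"
  by (intro borel_measurable_continuous_onI continuous_on_binom_tail)

text \<open>Only the \<open>k\<close> summands with \<open>j < k\<close> are missing from the full
  binomial expansion; each contains the power \<open>(1 - q) ^ (n - j)\<close>, which decays
  exponentially in \<open>q * (n - k)\<close>.\<close>

lemma binom_tail_compl_le:
  assumes "k \<le> n" "0 \<le> q" "q \<le> 1"
  shows "1 - binom_tail n k q \<le> real k * (1 + real n * q) ^ k * exp (- (q * real (n - k)))"
proof -
  have "binom_tail n 0 q = (\<Sum>j\<in>{..<k} \<union> {k..n}. real (n choose j) * q ^ j * (1 - q) ^ (n - j))"
    unfolding binom_tail_def using assms by (intro sum.cong) auto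
  also have "\<dots> = (\<Sum>j<k. real (n choose j) * q ^ j * (1 - q) ^ (n - j)) + binom_tail n k q"
    unfolding binom_tail_def by (subst sum.union_disjoint) auto
  finally have "1 - binom_tail n k q = (\<Sum>j<k. real (n choose j) * q ^ j * (1 - q) ^ (n - j))"
    by (simp add: binom_tail_0)
  also have "\<dots> \<le> (\<Sum>j<k. (1 + real n * q) ^ k * exp (- (q * real (n - k))))"
  proof (intro sum_mono mult_mono)
    fix j assume "j \<in> {..<k}"
    then have j: "j < k" by simp
    have "real (n choose j) \<le> real n ^ j"
      using binomial_le_power[of n j] by (simp flip: of_nat_power)
    then have "real (n choose j) * q ^ j \<le> (real n * q) ^ j"
      using assms by (auto simp: power_mult_distrib intro!: mult_right_mono)
    \<comment> \<open>The base is raised to at least \<open>1\<close>, so that the exponent may then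
      be increased from \<open>j\<close> to \<open>k\<close>.\<close>
    also have "\<dots> \<le> (1 + real n * q) ^ j" using assms by (intro power_mono) auto
    also have "\<dots> \<le> (1 + real n * q) ^ k" using assms j by (intro power_increasing) auto
    finally show "real (n choose j) * q ^ j \<le> (1 + real n * q) ^ k" .
    have "(1 - q) ^ (n - j) \<le> (1 - q) ^ (n - k)"
      using assms j by (intro power_decreasing) auto
    also have "\<dots> \<le> exp (- q) ^ (n - k)"
      using assms exp_ge_add_one_self[of "- q"] by (intro power_mono) auto
    also have "\<dots> = exp (- (q * real (n - k)))"
      by (simp add: exp_of_nat_mult[symmetric] mult.commute)
    finally show "(1 - q) ^ (n - j) \<le> exp (- (q * real (n - k)))" .
  qed (use assms in auto)
  finally show ?thesis by simp
qed

text \<open>Integration by parts: up to the factor \<open>c * n / (k - 1)\<close>, the derivative of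
  \<open>binom_tail n k (c * t)\<close> divided by \<open>t\<close> is the derivative of the tail
  with parameters \<open>n - 1\<close> and \<open>k - 1\<close>. The left-hand side is the
  layer-cake form of a truncated first inverse moment whose law is exactly
  \<open>binom_tail n k (c * t)\<close>.\<close>

lemma binom_tail_integral:
  assumes k: "2 \<le> k" and c: "0 \<le> c" and b: "0 < b" "c * b \<le> 1" and n: "k \<le> n"
  shows "set_integrable lborel {0<..<b} (\<lambda>t. binom_tail n k (c * t) / t\<^sup>2)"
    and "(LBINT t:{0<..<b}. binom_tail n k (c * t) / t\<^sup>2) + binom_tail n k (c * b) / b
      = c * real n / (real k - 1) * binom_tail (n - 1) (k - 1) (c * b)"
proof -
  have ct: "0 \<le> c * t" "c * t \<le> 1" if "t \<in> {0<..<b}" for t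
    using that c b mult_left_mono[of t b c] by auto
  show int: "set_integrable lborel {0<..<b} (\<lambda>t. binom_tail n k (c * t) / t\<^sup>2)"
    unfolding set_integrable_def
  proof (rule integrableI_bounded_set_indicator[where B="(real n * c) ^ k * b ^ (k - 2)"])
    have "\<bar>binom_tail n k (c * t) / t\<^sup>2\<bar> \<le> (real n * c) ^ k * b ^ (k - 2)" if t: "t \<in> {0<..<b}" for t
    proof -
      have "binom_tail n k (c * t) \<le> (real n * (c * t)) ^ k"
        using ct[OF t] k by (intro binom_tail_le) auto
      also have "\<dots> = (real n * c) ^ k * t ^ (k - 2) * t\<^sup>2"
        using k by (simp add: power_mult_distrib mult.assoc del: power2_eq_square power_Suc) (metis le_add_diff_inverse2 power_add)
      finally have "binom_tail n k (c * t) / t\<^sup>2 \<le> (real n * c) ^ k * t ^ (k - 2)"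
        using t by (simp add: divide_le_eq)
      also have "\<dots> \<le> (real n * c) ^ k * b ^ (k - 2)"
        using t c by (intro mult_left_mono power_mono) auto
      finally show ?thesis using binom_tail_nonneg[OF ct[OF t]] by simp
    qed
    then show "AE t in lborel. t \<in> {0<..<b} \<longrightarrow> norm (binom_tail n k (c * t) / t\<^sup>2) \<le> (real n * c) ^ k * b ^ (k - 2)"
      by auto
  qed (use b in auto)
  \<comment> \<open>\<open>g\<close> is \<open>binom_tail n k (c * t) / t\<close> with the factor
    \<open>t\<close> cancelled in every summand. It is a polynomial, hence continuous at
    \<open>0\<close>, and it vanishes there because \<open>k\<close> is at least
    \<open>2\<close>.\<close>
  define g where "g t = (\<Sum>j=k..n. real (n choose j) * c ^ j * t ^ (j - 1) * (1 - c * t) ^ (n - j))" for t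
  have g: "g t = binom_tail n k (c * t) / t" if "t \<noteq> 0" for t
  proof -
    have "t * g t = binom_tail n k (c * t)"
      unfolding g_def binom_tail_def sum_distrib_left
    proof (intro sum.cong refl)
      fix j assume "j \<in> {k..n}"
      then have "t ^ j = t * t ^ (j - 1)" using k by (cases j) auto
      then show "t * (real (n choose j) * c ^ j * t ^ (j - 1) * (1 - c * t) ^ (n - j)) =
         real (n choose j) * (c * t) ^ j * (1 - c * t) ^ (n - j)"
        by (simp add: power_mult_distrib)
    qed
    then show ?thesis using that by (simp add: field_simps)
  qed
  have g0: "g 0 = 0" unfolding g_def using k by (intro sum.neutral) (auto simp: power_0_left)
  define F where "F t = c * real n / (real k - 1) * binom_tail (n - 1) (k - 1) (c * t) - g t" for t
  have F0: "F 0 = 0" using k by (simp add: F_def g0 binom_tail_zero)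
  \<comment> \<open>The absorption identity that matches the coefficients of the two derivatives, so
    that only the integrand \<open>binom_tail n k (c * t) / t\<^sup>2\<close> survives in the
    derivative of \<open>F\<close>.\<close>
  have ch: "real (n - 1) * real ((n - 2) choose (k - 2)) = (real k - 1) * real ((n - 1) choose (k - 1))"
  proof -
    have "Suc (k - 2) * (Suc (n - 2) choose Suc (k - 2)) = Suc (n - 2) * ((n - 2) choose (k - 2))"
      by (simp only: Suc_times_binomial_eq) (simp add: mult.commute)
    moreover have "Suc (k - 2) = k - 1" "Suc (n - 2) = n - 1" using k n by auto
    ultimately have "real ((k - 1) * ((n - 1) choose (k - 1))) = real ((n - 1) * ((n - 2) choose (k - 2)))"
      by metis
    then show ?thesis using k by (simp add: of_nat_diff)
  qed
  have "((\<lambda>t. binom_tail n k (c * t) / t\<^sup>2) has_integral (F b - F 0)) {0..b}"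
  proof (rule fundamental_theorem_of_calculus_interior)
    show "continuous_on {0..b} F"
      unfolding F_def g_def using k
      by (intro continuous_intros continuous_on_compose2[OF continuous_on_binom_tail[of UNIV]]) auto
    fix t assume t: "t \<in> {0<..<b}"
    have D1: "((\<lambda>t. binom_tail (n - 1) (k - 1) (c * t)) has_field_derivative
       (real (n - 1) * real ((n - 1 - 1) choose (k - 1 - 1)) * (c * t) ^ (k - 1 - 1) * (1 - c * t) ^ (n - 1 - (k - 1))) * c) (at t)"
      using k n by (intro DERIV_chain2[OF has_field_derivative_binom_tail]) (auto intro!: derivative_eq_intros)
    have D2: "((\<lambda>t. binom_tail n k (c * t)) has_field_derivative
       (real n * real ((n - 1) choose (k - 1)) * (c * t) ^ (k - 1) * (1 - c * t) ^ (n - k)) * c) (at t)"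
      using k n by (intro DERIV_chain2[OF has_field_derivative_binom_tail]) (auto intro!: derivative_eq_intros)
    have D3: "((\<lambda>t. binom_tail n k (c * t) / t) has_field_derivative
       (real n * real ((n - 1) choose (k - 1)) * (c * t) ^ (k - 1) * (1 - c * t) ^ (n - k)) * c / t
         - binom_tail n k (c * t) / t\<^sup>2) (at t)"
      by (rule DERIV_cong[OF DERIV_divide[OF D2 DERIV_ident]])
        (use t in \<open>simp_all add: power2_eq_square field_simps\<close>)
    have D4: "(g has_field_derivative
       (real n * real ((n - 1) choose (k - 1)) * (c * t) ^ (k - 1) * (1 - c * t) ^ (n - k)) * c / t
         - binom_tail n k (c * t) / t\<^sup>2) (at t)"
      by (rule has_field_derivative_transform_within_open[OF D3, of "{0<..<b}"]) (use t g in auto)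
    have "(F has_field_derivative 
        c * real n / (real k - 1) * ((real (n - 1) * real ((n - 1 - 1) choose (k - 1 - 1)) * (c * t) ^ (k - 1 - 1) * (1 - c * t) ^ (n - 1 - (k - 1))) * c)
        - ((real n * real ((n - 1) choose (k - 1)) * (c * t) ^ (k - 1) * (1 - c * t) ^ (n - k)) * c / t
         - binom_tail n k (c * t) / t\<^sup>2)) (at t)"
      unfolding F_def by (intro DERIV_diff DERIV_cmult D1 D4)
    moreover have "c * real n / (real k - 1) * ((real (n - 1) * real ((n - 1 - 1) choose (k - 1 - 1)) * (c * t) ^ (k - 1 - 1) * (1 - c * t) ^ (n - 1 - (k - 1))) * c)
      = (real n * real ((n - 1) choose (k - 1)) * (c * t) ^ (k - 1) * (1 - c * t) ^ (n - k)) * c / t"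
    proof -
      have "c * real n / (real k - 1) * ((real (n - 1) * real ((n - 1 - 1) choose (k - 1 - 1)) * (c * t) ^ (k - 1 - 1) * (1 - c * t) ^ (n - 1 - (k - 1))) * c)
        = c * real n / (real k - 1) * ((real (n - 1) * real ((n - 2) choose (k - 2))) * (c * t) ^ (k - 2) * (1 - c * t) ^ (n - k) * c)"
        using k n by (simp add: numeral_2_eq_2)
      also have "\<dots> = c * real n * real ((n - 1) choose (k - 1)) * (c * t) ^ (k - 2) * (1 - c * t) ^ (n - k) * c"
        unfolding ch using k by simp
      also have "\<dots> = (real n * real ((n - 1) choose (k - 1)) * (c * t) ^ (k - 1) * (1 - c * t) ^ (n - k)) * c / t"
      proof -
        have "k - 1 = Suc (k - 2)" using k by simp
        then have "(c * t) ^ (k - 1) = c * t * (c * t) ^ (k - 2)" by (metis power_Suc)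
        then show ?thesis using t by simp
      qed
      finally show ?thesis .
    qed
    ultimately show "(F has_vector_derivative binom_tail n k (c * t) / t\<^sup>2) (at t)"
      by (simp add: has_real_derivative_iff_has_vector_derivative)
  qed (use b in auto)
  moreover have "((\<lambda>t. binom_tail n k (c * t) / t\<^sup>2) has_integral (LBINT t:{0<..<b}. binom_tail n k (c * t) / t\<^sup>2)) {0..b}"
    unfolding has_integral_Icc_iff_Ioo
    using set_borel_integral_eq_integral[OF int] by (simp add: has_integral_iff)
  ultimately have "(LBINT t:{0<..<b}. binom_tail n k (c * t) / t\<^sup>2) = F b"
    by (metis F0 diff_zero has_integral_unique)
  then show "(LBINT t:{0<..<b}. binom_tail n k (c * t) / t\<^sup>2) + binom_tail n k (c * b) / b
      = c * real n / (real k - 1) * binom_tail (n - 1) (k - 1) (c * b)"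
    using b by (simp add: F_def g)
qed

section \<open>Truncated inverse moments\<close>

text \<open>The antiderivative is \<open>- 1 / t ^ a\<close>. The boundary term at \<open>b\<close>
  stands on the left to avoid subtraction in \<open>ennreal\<close>.\<close>

lemma nn_integral_inverse_power_Ioo:
  assumes "0 < u" "u < b" "0 < a"
  shows "(\<integral>\<^sup>+t\<in>{u<..<b}. ennreal (real a / t ^ Suc a) \<partial>lborel) + ennreal (1 / b ^ a) = ennreal (1 / u ^ a)"
proof -
  have "(\<integral>\<^sup>+t\<in>{u<..<b}. ennreal (real a / t ^ Suc a) \<partial>lborel)
      = (\<integral>\<^sup>+t. ennreal (real a / t ^ Suc a) * indicator {u..b} t \<partial>lborel)"
  proof (rule nn_integral_cong_AE)
    show "AE t in lborel. ennreal (real a / t ^ Suc a) * indicator {u<..<b} t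
       = ennreal (real a / t ^ Suc a) * indicator {u..b} t"
      using AE_lborel_singleton[of u] AE_lborel_singleton[of b]
      by eventually_elim (auto simp: indicator_def)
  qed
  also have "\<dots> = ennreal ((- 1 / b ^ a) - (- 1 / u ^ a))"
  proof (rule nn_integral_FTC_Icc)
    fix t assume t: "t \<in> {u..b}"
    have *: "t ^ a = t * t ^ (a - 1)" using assms by (cases a) auto
    show "((\<lambda>t. - 1 / t ^ a) has_real_derivative real a / t ^ Suc a) (at t)"
      using t assms by (auto intro!: derivative_eq_intros simp: * field_simps)
    show "0 \<le> real a / t ^ Suc a" using t assms by auto
  qed (use assms in auto)
  finally show ?thesis
    using assms by (simp flip: ennreal_plus add: power_mono frac_le)
qed

text \<open>Layer-cake formula: for \<open>0 < U \<omega> < b\<close>, the value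
  \<open>1 / U \<omega> ^ a\<close> is the integral of \<open>a / t ^ (a + 1)\<close> from
  \<open>U \<omega>\<close> to \<open>b\<close> plus \<open>1 / b ^ a\<close>; for
  \<open>U \<omega> \<ge> b\<close> both sides are \<open>0\<close>. Tonelli then turns the
  indicator of \<open>U \<omega> < t\<close> into the distribution function.\<close>

lemma (in prob_space) nn_integral_truncated_inverse_power:
  assumes U [measurable]: "random_variable borel U" and pos: "AE \<omega> in M. 0 < U \<omega>"
    and b: "0 < b" and a: "0 < a"
  shows "(\<integral>\<^sup>+\<omega>. ennreal (1 / U \<omega> ^ a * indicator {0<..<b} (U \<omega>)) \<partial>M)
    = (\<integral>\<^sup>+t\<in>{0<..<b}. ennreal (real a * \<P>(\<omega> in M. U \<omega> < t) / t ^ Suc a) \<partial>lborel)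
      + ennreal (\<P>(\<omega> in M. U \<omega> < b) / b ^ a)"
proof -
  interpret L: pair_sigma_finite M lborel ..
  define f where "f \<omega> t = ennreal (real a / t ^ Suc a) * indicator {0<..<b} t * indicator {\<omega>. U \<omega> < t} \<omega>" for \<omega> and t :: real
  have meas: "(\<lambda>(\<omega>, t). f \<omega> t) \<in> borel_measurable (M \<Otimes>\<^sub>M lborel)"
    unfolding f_def by measurable
  have "(\<integral>\<^sup>+\<omega>. ennreal (1 / U \<omega> ^ a * indicator {0<..<b} (U \<omega>)) \<partial>M)
    = (\<integral>\<^sup>+\<omega>. (\<integral>\<^sup>+t. f \<omega> t \<partial>lborel) + ennreal (1 / b ^ a) * indicator {\<omega>\<in>space M. U \<omega> < b} \<omega> \<partial>M)"
  proof (rule nn_integral_cong_AE)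
    show "AE \<omega> in M. ennreal (1 / U \<omega> ^ a * indicator {0<..<b} (U \<omega>))
       = (\<integral>\<^sup>+t. f \<omega> t \<partial>lborel) + ennreal (1 / b ^ a) * indicator {\<omega>\<in>space M. U \<omega> < b} \<omega>"
      using pos AE_space
    proof eventually_elim
      case (elim \<omega>)
      have "(\<integral>\<^sup>+t. f \<omega> t \<partial>lborel) = (\<integral>\<^sup>+t\<in>{U \<omega><..<b}. ennreal (real a / t ^ Suc a) \<partial>lborel)"
        using elim by (intro nn_integral_cong) (auto simp: f_def indicator_def)
      then show ?case
        using nn_integral_inverse_power_Ioo[of "U \<omega>" b a] elim a
        by (cases "U \<omega> < b") (auto simp: indicator_def)
    qed
  qed
  also have "\<dots> = (\<integral>\<^sup>+\<omega>. \<integral>\<^sup>+t. f \<omega> t \<partial>lborel \<partial>M) + ennreal (1 / b ^ a) * emeasure M {\<omega>\<in>space M. U \<omega> < b}"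
    using meas by (subst nn_integral_add) (auto simp: nn_integral_cmult)
  also have "(\<integral>\<^sup>+\<omega>. \<integral>\<^sup>+t. f \<omega> t \<partial>lborel \<partial>M) = (\<integral>\<^sup>+t. \<integral>\<^sup>+\<omega>. f \<omega> t \<partial>M \<partial>lborel)"
    using L.Fubini'[OF meas] by simp
  also have "\<dots> = (\<integral>\<^sup>+t\<in>{0<..<b}. ennreal (real a * \<P>(\<omega> in M. U \<omega> < t) / t ^ Suc a) \<partial>lborel)"
  proof (rule nn_integral_cong)
    fix t :: real
    have "(\<integral>\<^sup>+\<omega>. f \<omega> t \<partial>M) = ennreal (real a / t ^ Suc a) * indicator {0<..<b} t * emeasure M {\<omega>\<in>space M. U \<omega> < t}"
      unfolding f_def
      by (subst nn_integral_cmult_indicator[symmetric], simp, intro nn_integral_cong) (auto simp: indicator_def)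
    then show "(\<integral>\<^sup>+\<omega>. f \<omega> t \<partial>M) = ennreal (real a * \<P>(\<omega> in M. U \<omega> < t) / t ^ Suc a) * indicator {0<..<b} t"
      by (auto simp: emeasure_eq_measure indicator_def ennreal_mult[symmetric])
  qed
  finally show ?thesis
    using b by (simp add: emeasure_eq_measure ennreal_mult[symmetric])
qed

text \<open>A distribution function of order \<open>t ^ k\<close> with \<open>k > a\<close> makes
  the layer-cake integrand bounded on \<open>(0, b)\<close>, so all terms are finite and the formula
  passes from \<open>ennreal\<close> to the reals.\<close>

lemma (in prob_space) expectation_truncated_inverse_power:
  assumes U [measurable]: "random_variable borel U" and pos: "AE \<omega> in M. 0 < U \<omega>"
    and b: "0 < b" and a: "0 < a" and k: "a < k"
    and le: "\<And>t. 0 < t \<Longrightarrow> t \<le> b \<Longrightarrow> \<P>(\<omega> in M. U \<omega> < t) \<le> B * t ^ k"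
  shows "integrable M (\<lambda>\<omega>. 1 / U \<omega> ^ a * indicator {0<..<b} (U \<omega>))"
    and "set_integrable lborel {0<..<b} (\<lambda>t. real a * \<P>(\<omega> in M. U \<omega> < t) / t ^ Suc a)"
    and "expectation (\<lambda>\<omega>. 1 / U \<omega> ^ a * indicator {0<..<b} (U \<omega>))
      = (LBINT t:{0<..<b}. real a * \<P>(\<omega> in M. U \<omega> < t) / t ^ Suc a) + \<P>(\<omega> in M. U \<omega> < b) / b ^ a"
proof -
  define F where "F t = \<P>(\<omega> in M. U \<omega> < t)" for t
  have [measurable]: "F \<in> borel_measurable borel"
    unfolding F_def by (intro borel_measurable_mono monoI finite_measure_mono) auto
  have F0: "0 \<le> F t" for t by (simp add: F_def)
  \<comment> \<open>Nonnegativity of \<open>B\<close> follows from the assumed bound at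
    \<open>t = b\<close>.\<close>
  have "0 \<le> B * b ^ k" using le[of b] b F0[of b] unfolding F_def by linarith
  then have B: "0 \<le> B"
    using zero_less_power[OF b, of k] unfolding zero_le_mult_iff by linarith
  have bound: "real a * F t / t ^ Suc a \<le> real a * (B * b ^ (k - Suc a))" if t: "0 < t" "t \<le> b" for t
  proof -
    have "F t / t ^ Suc a \<le> B * t ^ k / t ^ Suc a"
      using t le[OF t] by (intro divide_right_mono) (auto simp: F_def)
    also have "\<dots> = B * t ^ (k - Suc a)"
      using t k power_diff[of t "Suc a" k] by simp
    also have "\<dots> \<le> B * b ^ (k - Suc a)"
      using t B by (intro mult_left_mono power_mono) auto
    finally show ?thesis using mult_left_mono[of "F t / t ^ Suc a" _ "real a"] by simp
  qed
  show int: "set_integrable lborel {0<..<b} (\<lambda>t. real a * \<P>(\<omega> in M. U \<omega> < t) / t ^ Suc a)"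
    unfolding F_def[symmetric] set_integrable_def
  proof (rule integrableI_bounded_set_indicator[where B="real a * (B * b ^ (k - Suc a))"])
    show "AE t in lborel. t \<in> {0<..<b} \<longrightarrow> norm (real a * F t / t ^ Suc a) \<le> real a * (B * b ^ (k - Suc a))"
      using bound F0 by auto
  qed (use b in auto)
  let ?Y = "\<lambda>\<omega>. 1 / U \<omega> ^ a * indicator {0<..<b} (U \<omega>) :: real"
  let ?J = "LBINT t:{0<..<b}. real a * F t / t ^ Suc a"
  have J: "0 \<le> ?J" unfolding set_lebesgue_integral_def
    by (intro integral_nonneg_AE AE_I2) (auto simp: indicator_def F0)
  have "(\<integral>\<^sup>+t\<in>{0<..<b}. ennreal (real a * F t / t ^ Suc a) \<partial>lborel)
      = (\<integral>\<^sup>+t. ennreal (indicator {0<..<b} t *\<^sub>R (real a * F t / t ^ Suc a)) \<partial>lborel)"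
    by (intro nn_integral_cong) (auto simp: indicator_def)
  also have "\<dots> = ennreal ?J"
    using int unfolding set_lebesgue_integral_def set_integrable_def F_def[symmetric]
    by (intro nn_integral_eq_integral) (auto simp: indicator_def F0)
  finally have nn: "(\<integral>\<^sup>+\<omega>. ennreal (?Y \<omega>) \<partial>M) = ennreal (?J + F b / b ^ a)"
    using nn_integral_truncated_inverse_power[OF U pos b a] J F0[of b] b
    by (simp add: F_def[symmetric])
  have Y0: "0 \<le> ?Y \<omega>" for \<omega> by (simp add: indicator_def)
  show "integrable M ?Y"
    by (rule integrableI_nonneg) (use nn Y0 in \<open>auto\<close>)
  show "expectation ?Y = (LBINT t:{0<..<b}. real a * \<P>(\<omega> in M. U \<omega> < t) / t ^ Suc a) + \<P>(\<omega> in M. U \<omega> < b) / b ^ a"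
    unfolding F_def[symmetric]
  proof -
    have "expectation ?Y = enn2real (\<integral>\<^sup>+\<omega>. ennreal (?Y \<omega>) \<partial>M)"
      using Y0 by (intro integral_eq_nn_integral) auto
    then show "expectation ?Y = ?J + F b / b ^ a"
      unfolding nn using J F0[of b] b by (subst (asm) enn2real_ennreal) auto
  qed
qed

text \<open>One block in the abstract: \<open>U\<close> stands for the normalised volume,
  \<open>q t\<close> for the mass of the ball of volume \<open>t / n\<close>, \<open>p0\<close> for
  the density at the point, and \<open>s\<close> for \<open>\<sigma> / d\<close>. The condition on
  \<open>(p0 + C) * \<nu>\<close> keeps \<open>q t\<close> and its main term below \<open>1\<close>
  up to \<open>t = \<nu>\<close>.\<close>

locale binom_tail_law = prob_space +
  fixes U :: "'a \<Rightarrow> real" and n k :: nat and q :: "real \<Rightarrow> real" and p0 C s \<nu> :: real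
  assumes U: "random_variable borel U" and U_pos: "AE \<omega> in M. 0 < U \<omega>"
    and k: "3 \<le> k" "k \<le> n" and p0: "0 \<le> p0" and C: "0 \<le> C" and s: "0 \<le> s"
    and \<nu>: "1 \<le> \<nu>" "\<nu> \<le> real n" "(p0 + C) * \<nu> \<le> real n"
    and U_law: "\<And>t. 0 < t \<Longrightarrow> t \<le> \<nu> \<Longrightarrow> \<P>(\<omega> in M. U \<omega> < t) = binom_tail n k (q t)"
    and q_nonneg: "\<And>t. 0 \<le> q t"
    and q_approx: "\<And>t. 0 < t \<Longrightarrow> t \<le> \<nu> \<Longrightarrow> \<bar>q t - p0 * (t / real n)\<bar> \<le> C * (t / real n) powr (1 + s)"
begin

lemma n_pos: "0 < real n" using k by simp

lemma q_le: "0 < t \<Longrightarrow> t \<le> \<nu> \<Longrightarrow> q t \<le> (p0 + C) * (t / real n)"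
proof -
  assume t: "0 < t" "t \<le> \<nu>"
  have "(t / real n) powr (1 + s) \<le> (t / real n) powr 1"
    using t \<nu> s n_pos by (intro powr_mono') (auto simp: divide_le_eq)
  then have "C * (t / real n) powr (1 + s) \<le> C * (t / real n)"
    using t C n_pos by (intro mult_left_mono) auto
  then show ?thesis using q_approx[OF t] unfolding distrib_right by linarith
qed

lemma q0_le: "0 < t \<Longrightarrow> t \<le> \<nu> \<Longrightarrow> (p0 + C) * (t / real n) \<le> 1"
proof -
  assume t: "0 < t" "t \<le> \<nu>"
  have "(p0 + C) * t \<le> (p0 + C) * \<nu>" using t p0 C by (intro mult_left_mono) auto
  also have "\<dots> \<le> real n" by (rule \<nu>)
  finally show ?thesis using n_pos by (simp add: divide_le_eq)
qed

text \<open>Decay of order \<open>t ^ k\<close> at \<open>0\<close> makes \<open>1 / U ^ a\<close>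
  integrable below the truncation level for \<open>a < k\<close>; the second moment uses this with
  \<open>a = 2\<close> and \<open>k \<ge> 3\<close>.\<close>

lemma U_law_le: "0 < t \<Longrightarrow> t \<le> \<nu> \<Longrightarrow> \<P>(\<omega> in M. U \<omega> < t) \<le> (p0 + C) ^ k * t ^ k"
proof -
  assume t: "0 < t" "t \<le> \<nu>"
  have "binom_tail n k (q t) \<le> (real n * q t) ^ k"
    using q_nonneg order_trans[OF q_le[OF t] q0_le[OF t]] k by (intro binom_tail_le) auto
  also have "\<dots> \<le> ((p0 + C) * t) ^ k"
    using q_le[OF t] q_nonneg[of t] n_pos by (intro power_mono) (auto simp: field_simps)
  finally show ?thesis using U_law[OF t] by (simp add: power_mult_distrib)
qed

text \<open>The truncated estimator of one block, with lower truncation level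
  \<open>0\<close>.\<close>

abbreviation "Y \<equiv> \<lambda>\<omega>. (real k - 1) / U \<omega> * indicator {0<..<\<nu>} (U \<omega>)"

lemma \<nu>_pos: "0 < \<nu>" using \<nu> by simp

text \<open>Layer-cake formula with \<open>a = 2\<close>: the integral contributes at most
  \<open>2 * (p0 + C) ^ k * \<nu> ^ (k - 2)\<close> and the boundary term once more the same without
  the factor \<open>2\<close>. The exponent is then relaxed to \<open>k\<close>, as
  \<open>\<nu> \<ge> 1\<close>.\<close>

lemma second_moment:
  shows "integrable M (\<lambda>\<omega>. (Y \<omega>)\<^sup>2)"
    and "expectation (\<lambda>\<omega>. (Y \<omega>)\<^sup>2) \<le> 3 * (real k - 1)\<^sup>2 * (p0 + C) ^ k * \<nu> ^ k"
proof -
  have k2: "2 < k" using k by simp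
  have eq: "(Y \<omega>)\<^sup>2 = (real k - 1)\<^sup>2 * (1 / U \<omega> ^ 2 * indicator {0<..<\<nu>} (U \<omega>))" for \<omega>
    by (simp add: indicator_def power_divide)
  note E = expectation_truncated_inverse_power[OF U U_pos \<nu>_pos zero_less_numeral k2 U_law_le]
  show "integrable M (\<lambda>\<omega>. (Y \<omega>)\<^sup>2)"
    unfolding eq by (intro integrable_mult_right E(1))
  let ?A = "(p0 + C) ^ k"
  have A: "0 \<le> ?A" using p0 C by simp
  have b: "\<P>(\<omega> in M. U \<omega> < t) / t ^ 3 \<le> ?A * \<nu> ^ (k - 3)" if t: "0 < t" "t \<le> \<nu>" for t
  proof -
    have "\<P>(\<omega> in M. U \<omega> < t) / t ^ 3 \<le> ?A * t ^ k / t ^ 3"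
      using U_law_le[OF t] t by (intro divide_right_mono) auto
    also have "\<dots> = ?A * t ^ (k - 3)" using t k power_diff[of t 3 k] by simp
    also have "\<dots> \<le> ?A * \<nu> ^ (k - 3)" using t A by (intro mult_left_mono power_mono) auto
    finally show ?thesis .
  qed
  have "(LBINT t:{0<..<\<nu>}. real 2 * \<P>(\<omega> in M. U \<omega> < t) / t ^ Suc 2) \<le> (LBINT t:{0<..<\<nu>}. 2 * (?A * \<nu> ^ (k - 3)))"
  proof (rule set_integral_mono[OF E(2)])
    show "set_integrable lborel {0<..<\<nu>} (\<lambda>t. 2 * (?A * \<nu> ^ (k - 3)))"
      using \<nu>_pos by (simp add: set_integrable_def del: integrable_mult_left_iff)
    show "real 2 * \<P>(\<omega> in M. U \<omega> < t) / t ^ Suc 2 \<le> 2 * (?A * \<nu> ^ (k - 3))" if "t \<in> {0<..<\<nu>}" for t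
      using b[of t] that by (simp add: eval_nat_numeral)
  qed auto
  also have "\<dots> = 2 * ?A * \<nu> ^ (k - 2)"
  proof -
    have "\<nu> ^ (k - 2) = \<nu> * \<nu> ^ (k - 3)"
    proof -
      have "k - 2 = Suc (k - 3)" using k by simp
      then show ?thesis by simp
    qed
    then show ?thesis using \<nu>_pos by (simp add: set_lebesgue_integral_def)
  qed
  finally have 1: "(LBINT t:{0<..<\<nu>}. real 2 * \<P>(\<omega> in M. U \<omega> < t) / t ^ Suc 2) \<le> 2 * ?A * \<nu> ^ (k - 2)" .
  have "\<P>(\<omega> in M. U \<omega> < \<nu>) / \<nu> ^ 2 \<le> ?A * \<nu> ^ k / \<nu> ^ 2"
    using U_law_le[OF \<nu>_pos] \<nu>_pos by (intro divide_right_mono) auto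
  also have "\<dots> = ?A * \<nu> ^ (k - 2)" using \<nu>_pos k power_diff[of \<nu> 2 k] by simp
  finally have "expectation (\<lambda>\<omega>. 1 / U \<omega> ^ 2 * indicator {0<..<\<nu>} (U \<omega>)) \<le> 3 * ?A * \<nu> ^ (k - 2)"
    using 1 E(3) by linarith
  also have "\<dots> \<le> 3 * ?A * \<nu> ^ k"
    using A \<nu> by (intro mult_left_mono power_increasing) auto
  finally have "(real k - 1)\<^sup>2 * expectation (\<lambda>\<omega>. 1 / U \<omega> ^ 2 * indicator {0<..<\<nu>} (U \<omega>)) \<le> (real k - 1)\<^sup>2 * (3 * ?A * \<nu> ^ k)"
    by (intro mult_left_mono) auto
  then show "expectation (\<lambda>\<omega>. (Y \<omega>)\<^sup>2) \<le> 3 * (real k - 1)\<^sup>2 * (p0 + C) ^ k * \<nu> ^ k"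
    unfolding eq integral_mult_right_zero by (simp only: mult_ac)
qed

text \<open>Replacing \<open>q t\<close> by \<open>p0 * t / n\<close> makes the layer-cake integral explicit; the result is \<open>p0\<close>
  up to the truncation at \<open>\<nu>\<close>.\<close>

lemma bias:
  "\<bar>expectation Y - p0\<bar> \<le> 2 * (real k - 1) * C * (p0 + C) ^ (k - 1) * \<nu> ^ k * \<nu> powr s * real n powr (- s)
     + p0 * real k * (1 + p0 * \<nu>) ^ k * exp (- (p0 * \<nu> * real (n - k) / real n))"
proof -
  have k1: "1 < k" using k by simp
  note E = expectation_truncated_inverse_power[OF U U_pos \<nu>_pos zero_less_one k1 U_law_le, simplified]
  \<comment> \<open>\<open>c * t\<close> is the idealised mass of the ball of volume
    \<open>t / n\<close>, as if the density were constantly \<open>p0\<close> there.\<close>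
  define c where "c = p0 / real n"
  have c: "0 \<le> c" using p0 by (simp add: c_def)
  have c\<nu>: "c * \<nu> \<le> 1"
  proof -
    have "p0 * \<nu> \<le> (p0 + C) * \<nu>" using C \<nu> by (intro mult_right_mono) auto
    then have "p0 * \<nu> \<le> real n" using \<nu> by linarith
    then show ?thesis using n_pos by (simp add: c_def divide_le_eq)
  qed
  have k2: "2 \<le> k" using k by simp
  note I = binom_tail_integral[OF k2 c \<nu>_pos c\<nu> k(2)]
  let ?F = "\<lambda>t. \<P>(\<omega> in M. U \<omega> < t)" and ?G = "\<lambda>t. binom_tail n k (c * t)"
  \<comment> \<open>A uniform bound for the difference of true and idealised law over
    \<open>t\<^sup>2\<close>: the Lipschitz factor \<open>n * ((p0 + C) * t) ^ (k - 1)\<close> times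
    the error \<open>C * (t / n) powr (1 + s)\<close>. One power of \<open>n\<close> cancels and
    \<open>n powr (- s)\<close> remains.\<close>
  define D where "D = C * (p0 + C) ^ (k - 1) * \<nu> ^ (k - 2) * \<nu> powr s * real n powr (- s)"
  have diff: "\<bar>?F t - ?G t\<bar> / t\<^sup>2 \<le> D" if t: "0 < t" "t \<le> \<nu>" for t
  proof -
    have ct: "c * t \<le> (p0 + C) * (t / real n)"
      using C t n_pos by (simp add: c_def divide_right_mono mult_right_mono)
    have "\<bar>?F t - ?G t\<bar> \<le> real n * (real n * ((p0 + C) * (t / real n))) ^ (k - 1) * \<bar>q t - c * t\<bar>"
      unfolding U_law[OF t] using q_nonneg q_le[OF t] q0_le[OF t] c t k ct
      by (intro binom_tail_lipschitz) auto
    also have "\<dots> \<le> real n * (real n * ((p0 + C) * (t / real n))) ^ (k - 1) * (C * (t / real n) powr (1 + s))"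
      using q_approx[OF t] p0 C t by (intro mult_left_mono) (auto simp: c_def)
    also have "\<dots> = real n * ((p0 + C) * t) ^ (k - 1) * (C * (t / real n * (t powr s * real n powr (- s))))"
    proof -
      have "real n * ((p0 + C) * (t / real n)) = (p0 + C) * t" using n_pos by simp
      moreover have "(t / real n) powr (1 + s) = t / real n * (t powr s * real n powr (- s))"
        using t n_pos by (simp add: powr_add powr_divide powr_minus_divide)
      ultimately show ?thesis by simp
    qed
    also have "\<dots> = C * (p0 + C) ^ (k - 1) * (t ^ (k - 1) * t) * t powr s * real n powr (- s)"
      using n_pos by (simp add: power_mult_distrib)
    also have "t ^ (k - 1) * t = t\<^sup>2 * t ^ (k - 2)"
    proof -
      have "t ^ (k - 1) * t = t ^ k" using k by (simp flip: power_Suc2)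
      also have "\<dots> = t\<^sup>2 * t ^ (k - 2)" using k2 by (metis le_add_diff_inverse power_add)
      finally show ?thesis .
    qed
    finally have "\<bar>?F t - ?G t\<bar> / t\<^sup>2 \<le> C * (p0 + C) ^ (k - 1) * t ^ (k - 2) * t powr s * real n powr (- s)"
      using t by (simp add: divide_le_eq mult_ac)
    also have "\<dots> \<le> D" unfolding D_def
      using t C p0 s by (intro mult_right_mono mult_mono power_mono powr_mono2) auto
    finally show ?thesis .
  qed
  let ?E = "expectation (\<lambda>\<omega>. 1 / U \<omega> * indicator {0<..<\<nu>} (U \<omega>))"
  \<comment> \<open>The exact value of the layer-cake expression for the idealised law; multiplied
    by \<open>k - 1\<close> it is \<open>p0\<close> times a binomial tail.\<close>
  let ?H = "c * real n / (real k - 1) * binom_tail (n - 1) (k - 1) (c * \<nu>)"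
  have int: "set_integrable lborel {0<..<\<nu>} (\<lambda>t. ?F t / t\<^sup>2)"
    using E(2) by (simp add: power2_eq_square)
  have "?E = (LBINT t:{0<..<\<nu>}. ?F t / t\<^sup>2) + ?F \<nu> / \<nu>"
    using E(3) by (simp add: power2_eq_square)
  also have "\<dots> - ?H = (LBINT t:{0<..<\<nu>}. ?F t / t\<^sup>2 - ?G t / t\<^sup>2) + (?F \<nu> - ?G \<nu>) / \<nu>"
    unfolding I(2)[symmetric] using int I(1) by (simp add: diff_divide_distrib)
  finally have "\<bar>?E - ?H\<bar> \<le> \<bar>LBINT t:{0<..<\<nu>}. ?F t / t\<^sup>2 - ?G t / t\<^sup>2\<bar> + \<bar>(?F \<nu> - ?G \<nu>) / \<nu>\<bar>"
    by (simp only: abs_triangle_ineq)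
  also have "\<bar>LBINT t:{0<..<\<nu>}. ?F t / t\<^sup>2 - ?G t / t\<^sup>2\<bar> \<le> (LBINT t:{0<..<\<nu>}. D)"
  proof -
    have d: "set_integrable lborel {0<..<\<nu>} (\<lambda>t. ?F t / t\<^sup>2 - ?G t / t\<^sup>2)" using int I(1) by simp
    have "\<bar>LBINT t:{0<..<\<nu>}. ?F t / t\<^sup>2 - ?G t / t\<^sup>2\<bar> \<le> (LBINT t:{0<..<\<nu>}. \<bar>?F t / t\<^sup>2 - ?G t / t\<^sup>2\<bar>)"
      using set_integral_norm_bound[OF d] by simp
    also have "\<dots> \<le> (LBINT t:{0<..<\<nu>}. D)"
    proof (rule set_integral_mono)
      show "set_integrable lborel {0<..<\<nu>} (\<lambda>t. \<bar>?F t / t\<^sup>2 - ?G t / t\<^sup>2\<bar>)"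
        using set_integrable_norm[OF d] by simp
      show "\<bar>?F t / t\<^sup>2 - ?G t / t\<^sup>2\<bar> \<le> D" if "t \<in> {0<..<\<nu>}" for t
        using diff[of t] that by (simp flip: diff_divide_distrib)
    qed (use \<nu>_pos in \<open>simp add: set_integrable_def\<close>)
    finally show ?thesis .
  qed
  also have "\<dots> = D * \<nu>" using \<nu>_pos by (simp add: set_lebesgue_integral_def)
  \<comment> \<open>The boundary term obeys the same bound as the integral, since
    \<open>diff\<close> at \<open>\<nu>\<close> controls the difference by
    \<open>D * \<nu>\<^sup>2\<close>. This is the origin of the factor \<open>2\<close>.\<close>
  also have "\<bar>(?F \<nu> - ?G \<nu>) / \<nu>\<bar> \<le> D * \<nu>"
    using diff[OF \<nu>_pos order_refl] \<nu>_pos by (simp add: power2_eq_square divide_le_eq mult_ac)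
  finally have 1: "\<bar>?E - ?H\<bar> \<le> 2 * (D * \<nu>)" by simp
  have D\<nu>: "D * \<nu> \<le> C * (p0 + C) ^ (k - 1) * \<nu> ^ k * \<nu> powr s * real n powr (- s)"
  proof -
    have "\<nu> ^ (k - 2) * \<nu> \<le> \<nu> ^ k"
      using \<nu> k power_increasing[of "Suc (k - 2)" k \<nu>] by (simp add: mult.commute)
    then have "C * (p0 + C) ^ (k - 1) * (\<nu> ^ (k - 2) * \<nu>) * \<nu> powr s * real n powr (- s)
       \<le> C * (p0 + C) ^ (k - 1) * \<nu> ^ k * \<nu> powr s * real n powr (- s)"
      using C p0 by (intro mult_right_mono mult_left_mono) auto
    then show ?thesis by (simp add: D_def mult_ac)
  qed
  let ?T = "binom_tail (n - 1) (k - 1) (c * \<nu>)"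
  have EY: "expectation Y = (real k - 1) * ?E"
  proof -
    have "Y = (\<lambda>\<omega>. (real k - 1) * (1 / U \<omega> * indicator {0<..<\<nu>} (U \<omega>)))" by auto
    then show ?thesis by (simp only: integral_mult_right_zero)
  qed
  have H: "(real k - 1) * ?H = p0 * ?T"
    using k n_pos by (simp add: c_def)
  \<comment> \<open>The deficit \<open>1 - ?T\<close> is the loss caused by truncation at
    \<open>\<nu>\<close>. The exponential keeps \<open>n - k\<close>, because both parameters of the
    tail dropped by one.\<close>
  have T: "0 \<le> ?T" "1 - ?T \<le> real k * (1 + p0 * \<nu>) ^ k * exp (- (p0 * \<nu> * real (n - k) / real n))"
  proof -
    show "0 \<le> ?T" using c \<nu> c\<nu> by (intro binom_tail_nonneg) auto
    have "1 - ?T \<le> real (k - 1) * (1 + real (n - 1) * (c * \<nu>)) ^ (k - 1) * exp (- (c * \<nu> * real (n - 1 - (k - 1))))"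
      using c \<nu> c\<nu> k by (intro binom_tail_compl_le) auto
    also have "\<dots> \<le> real k * (1 + p0 * \<nu>) ^ k * exp (- (p0 * \<nu> * real (n - k) / real n))"
    proof (intro mult_mono)
      have "real (n - 1) * (c * \<nu>) \<le> real n * (c * \<nu>)"
        using c \<nu> by (intro mult_right_mono) auto
      also have "\<dots> = p0 * \<nu>" using n_pos by (simp add: c_def)
      finally have "(1 + real (n - 1) * (c * \<nu>)) ^ (k - 1) \<le> (1 + p0 * \<nu>) ^ (k - 1)"
        using c \<nu> by (intro power_mono) auto
      also have "\<dots> \<le> (1 + p0 * \<nu>) ^ k" using p0 \<nu> by (intro power_increasing) auto
      finally show "(1 + real (n - 1) * (c * \<nu>)) ^ (k - 1) \<le> (1 + p0 * \<nu>) ^ k" .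
      show "exp (- (c * \<nu> * real (n - 1 - (k - 1)))) \<le> exp (- (p0 * \<nu> * real (n - k) / real n))"
        using k by (simp add: c_def)
    qed (use c p0 \<nu> in auto)
    finally show "1 - ?T \<le> real k * (1 + p0 * \<nu>) ^ k * exp (- (p0 * \<nu> * real (n - k) / real n))" .
  qed
  have T1: "?T \<le> 1"
  proof -
    have "?T \<le> binom_tail (n - 1) 0 (c * \<nu>)"
      unfolding binom_tail_def using c \<nu> c\<nu> by (intro sum_mono2) auto
    then show ?thesis by (simp add: binom_tail_0)
  qed
  have "\<bar>expectation Y - p0\<bar> \<le> (real k - 1) * \<bar>?E - ?H\<bar> + p0 * (1 - ?T)"
  proof -
    have "expectation Y - p0 = (real k - 1) * (?E - ?H) - p0 * (1 - ?T)"
      unfolding EY right_diff_distrib H by simp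
    then show ?thesis using k p0 T1 abs_triangle_ineq4[of "(real k - 1) * (?E - ?H)" "p0 * (1 - ?T)"]
      by (simp add: abs_mult)
  qed
  also have "\<dots> \<le> (real k - 1) * (2 * (C * (p0 + C) ^ (k - 1) * \<nu> ^ k * \<nu> powr s * real n powr (- s)))
     + p0 * (real k * (1 + p0 * \<nu>) ^ k * exp (- (p0 * \<nu> * real (n - k) / real n)))"
    using 1 D\<nu> T k p0 by (intro add_mono mult_left_mono) auto
  finally show ?thesis by (simp only: mult_ac)
qed

end

section \<open>Nearest-neighbour volumes\<close>

text \<open>The entries below \<open>r\<close> form a prefix of the sorted list, and index
  \<open>j\<close> lies in this prefix iff its length exceeds \<open>j\<close>.\<close>

lemma sort_nth_less_iff:
  fixes xs :: "'a :: linorder list"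
  assumes "j < length xs"
  shows "sort xs ! j < r \<longleftrightarrow> j < length (filter (\<lambda>y. y < r) xs)"
proof -
  define ys where "ys = sort xs"
  have ys: "sorted ys" "length ys = length xs" by (auto simp: ys_def)
  have "length (filter (\<lambda>y. y < r) xs) = length (filter (\<lambda>y. y < r) ys)"
    unfolding ys_def by (metis filter_sort length_sort)
  also have "\<dots> = card {i. i < length ys \<and> ys ! i < r}"
    by (rule length_filter_conv_card)
  finally have len: "length (filter (\<lambda>y. y < r) xs) = card {i. i < length ys \<and> ys ! i < r}" .
  show ?thesis
  proof
    assume "sort xs ! j < r"
    then have "{..j} \<subseteq> {i. i < length ys \<and> ys ! i < r}"
      using sorted_nth_mono[OF ys(1)] assms ys unfolding ys_def[symmetric] by fastforce
    then have "card {..j} \<le> card {i. i < length ys \<and> ys ! i < r}" by (intro card_mono) auto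
    then show "j < length (filter (\<lambda>y. y < r) xs)" using len by simp
  next
    assume *: "j < length (filter (\<lambda>y. y < r) xs)"
    show "sort xs ! j < r"
    proof (rule ccontr)
      assume "\<not> sort xs ! j < r"
      then have "{i. i < length ys \<and> ys ! i < r} \<subseteq> {..<j}"
        using sorted_nth_mono[OF ys(1), of j] ys unfolding ys_def[symmetric]
        by (auto simp: not_less) (meson leD leI order_trans)
      then have "card {i. i < length ys \<and> ys ! i < r} \<le> card {..<j}" by (intro card_mono) auto
      then show False using * len by simp
    qed
  qed
qed

text \<open>The \<open>k\<close>-th smallest distance has index \<open>k - 1\<close>, so the strict
  comparison of index and count becomes \<open>k \<le>\<close> count. Strict inequality of distances
  corresponds to the open ball.\<close>

lemma knn_dist_less_iff:
  assumes "0 < k" "k \<le> n"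
  shows "knn_dist k n X x < r \<longleftrightarrow> k \<le> card {i \<in> {..<n}. X i \<in> ball x r}"
proof -
  have "length (filter (\<lambda>y. y < r) (map (\<lambda>i. dist x (X i)) [0..<n])) = card {i \<in> {..<n}. X i \<in> ball x r}"
    by (simp add: length_filter_conv_card conj_commute lessThan_def cong: conj_cong)
  then show ?thesis
    unfolding knn_dist_def using assms by (subst sort_nth_less_iff) auto
qed

lemma knn_dist_nonneg: "0 < k \<Longrightarrow> k \<le> n \<Longrightarrow> 0 \<le> knn_dist k n X x"
  using knn_dist_less_iff[of k n X x 0] by (auto simp: not_less[symmetric])

lemma knn_dist_cong: "(\<And>i. i < n \<Longrightarrow> X i = Y i) \<Longrightarrow> knn_dist k n X x = knn_dist k n Y x"
  unfolding knn_dist_def by (intro arg_cong2[where f=nth] arg_cong[where f=sort]) auto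

section \<open>Volumes of balls and the corresponding radii\<close>

lemma unit_ball_vol_CARD_pos: "0 < unit_ball_vol (real CARD('d::finite))"
  by (rule unit_ball_vol_pos) simp

lemma unit_ball_vol_CARD_nonzero [simp]: "unit_ball_vol (real CARD('d::finite)) \<noteq> 0"
  using unit_ball_vol_CARD_pos[where 'd='d] by linarith

text \<open>The radius of a ball of volume \<open>v\<close>. The type argument supplies the
  dimension, since neither \<open>v\<close> nor the result mentions it.\<close>

definition vol_radius :: "'d itself \<Rightarrow> real \<Rightarrow> real" where
  "vol_radius _ v = root CARD('d) (v / unit_ball_vol (real CARD('d)))"

lemma measure_ball_vec:
  fixes x :: "real ^ 'd::finite"
  shows "0 \<le> r \<Longrightarrow> measure lborel (ball x r) = unit_ball_vol (real CARD('d)) * r ^ CARD('d)"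
  using content_ball[of r x] by simp

lemma measure_ball_vol_radius:
  fixes x :: "real ^ 'd::finite"
  assumes "0 \<le> v"
  shows "measure lborel (ball x (vol_radius TYPE('d) v)) = v"
  using assms unit_ball_vol_CARD_pos[where 'd='d]
  by (subst measure_ball_vec) (auto simp: vol_radius_def)

lemma measure_ball_less_iff:
  fixes x :: "real ^ 'd::finite"
  assumes "0 \<le> r" "0 \<le> v"
  shows "measure lborel (ball x r) < v \<longleftrightarrow> r < vol_radius TYPE('d) v"
proof -
  define s where "s = vol_radius TYPE('d) v"
  have s: "0 \<le> s" using assms by (auto simp: s_def vol_radius_def)
  have v: "v = unit_ball_vol (real CARD('d)) * s ^ CARD('d)"
    using measure_ball_vol_radius[OF assms(2), of x] measure_ball_vec[OF s, of x] by (simp add: s_def)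
  show ?thesis
    unfolding s_def[symmetric] measure_ball_vec[OF assms(1)] by (subst v)
    (use assms s unit_ball_vol_CARD_pos[where 'd='d]
      power_strict_mono[of r s "CARD('d)"] power_mono[of s r "CARD('d)"]
    in \<open>auto simp: not_less[symmetric]\<close>)
qed

text \<open>Volume increases strictly with the radius, so the sublevel sets of the volume are
  counting events. Both measurability and the law of the volume are read off from this.\<close>

lemma knn_volume_less_iff:
  fixes x :: "real ^ 'd::finite"
  assumes "0 < k" "k \<le> n" "0 \<le> t"
  shows "knn_volume k n X x < t \<longleftrightarrow> k \<le> card {i \<in> {..<n}. X i \<in> ball x (vol_radius TYPE('d) (t / real n))}"
proof -
  have "knn_volume k n X x < t \<longleftrightarrow> measure lborel (ball x (knn_dist k n X x)) < t / real n"
    unfolding knn_volume_def using assms by (simp add: field_simps)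
  also have "\<dots> \<longleftrightarrow> knn_dist k n X x < vol_radius TYPE('d) (t / real n)"
    using assms knn_dist_nonneg[of k n X x] by (intro measure_ball_less_iff) auto
  finally show ?thesis using assms by (simp add: knn_dist_less_iff)
qed

lemma knn_volume_nonneg: "0 \<le> knn_volume k n X x"
  by (simp add: knn_volume_def)

lemma borel_measurable_knn_volume:
  assumes "0 < k" "k \<le> n"
  shows "(\<lambda>X. knn_volume k n X x) \<in> borel_measurable (\<Pi>\<^sub>M i\<in>{..<n}. (borel :: (real ^ 'd::finite) measure))"
proof (rule borel_measurableI_less)
  fix t :: real
  let ?P = "\<Pi>\<^sub>M i\<in>{..<n}. (borel :: (real ^ 'd) measure)"
  show "{X \<in> space ?P. knn_volume k n X x < t} \<in> sets ?P"
  proof (cases "t \<ge> 0")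
    case True
    \<comment> \<open>The count is rewritten as a sum of indicators, whose measurability is
      automatic.\<close>
    have "card {i \<in> {..<n}. Q i} = (\<Sum>i<n. if Q i then 1 else 0)" for Q
      by (simp add: sum.If_cases Int_def)
    moreover have "{X \<in> space ?P. k \<le> (\<Sum>i<n. if X i \<in> ball x (vol_radius TYPE('d) (t / real n)) then 1 else 0)} \<in> sets ?P"
      unfolding mem_ball by measurable
    ultimately have "{X \<in> space ?P. k \<le> card {i \<in> {..<n}. X i \<in> ball x (vol_radius TYPE('d) (t / real n))}} \<in> sets ?P"
      by simp
    then show ?thesis using True assms by (simp add: knn_volume_less_iff)
  next
    case False
    then have "{X \<in> space ?P. knn_volume k n X x < t} = {}"
      using knn_volume_nonneg[of k n _ x] by (force dest: le_less_trans)
    then show ?thesis by (simp only: sets.empty_sets)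
  qed
qed

text \<open>The event is split according to the exact set \<open>J\<close> of indices whose samples
  fall into \<open>A\<close>. Each piece \<open>B J\<close> is a box with product measure depending
  only on \<open>card J\<close>, and the number of such \<open>J\<close> is a binomial
  coefficient.\<close>

lemma measure_PiM_card_ge:
  assumes P: "prob_space P" and A: "A \<in> sets P" and I: "finite I"
  shows "measure (\<Pi>\<^sub>M i\<in>I. P) {X \<in> space (\<Pi>\<^sub>M i\<in>I. P). k \<le> card {i \<in> I. X i \<in> A}}
    = binom_tail (card I) k (measure P A)"
proof -
  interpret Q: prob_space P by fact
  interpret product_prob_space "\<lambda>_. P" I by unfold_locales
  interpret finite_product_prob_space "\<lambda>_. P" I by unfold_locales fact
  let ?M = "\<Pi>\<^sub>M i\<in>I. P" and ?q = "measure P A"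
  define B where "B J = (\<Pi>\<^sub>E i\<in>I. if i \<in> J then A else space P - A)" for J
  define S where "S = {J. J \<subseteq> I \<and> k \<le> card J}"
  have S: "finite S" using I by (auto simp: S_def)
  have B_eq: "{i \<in> I. X i \<in> A} = J" if "J \<in> S" "X \<in> B J" for X J
    using that by (auto simp: B_def S_def PiE_iff split: if_splits)
  have "{X \<in> space ?M. k \<le> card {i \<in> I. X i \<in> A}} = (\<Union>J\<in>S. B J)"
  proof (intro equalityI subsetI)
    fix X assume X: "X \<in> {X \<in> space ?M. k \<le> card {i \<in> I. X i \<in> A}}"
    then have "X \<in> B {i \<in> I. X i \<in> A}"
      by (auto simp: B_def space_PiM PiE_iff)
    moreover have "{i \<in> I. X i \<in> A} \<in> S" using X by (auto simp: S_def)
    ultimately show "X \<in> (\<Union>J\<in>S. B J)" by blast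
  next
    fix X assume "X \<in> (\<Union>J\<in>S. B J)"
    then obtain J where J: "J \<in> S" "X \<in> B J" by auto
    moreover have "X \<in> space ?M"
      using J sets.sets_into_space[OF A] by (fastforce simp: B_def space_PiM PiE_iff split: if_splits)
    ultimately show "X \<in> {X \<in> space ?M. k \<le> card {i \<in> I. X i \<in> A}}"
      using B_eq[OF J] by (simp add: S_def)
  qed
  also have "measure ?M \<dots> = (\<Sum>J\<in>S. measure ?M (B J))"
  proof (rule finite_measure_finite_Union[OF S])
    show "B ` S \<subseteq> sets ?M"
      using A I by (auto simp: B_def intro!: sets_PiM_I_finite)
    show "disjoint_family_on B S"
      unfolding disjoint_family_on_def using B_eq by blast
  qed
  also have "\<dots> = (\<Sum>J\<in>S. ?q ^ card J * (1 - ?q) ^ (card I - card J))"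
  proof (rule sum.cong[OF refl])
    fix J assume J: "J \<in> S"
    then have [simp]: "J \<subseteq> I" "finite J" using I by (auto simp: S_def intro: finite_subset)
    have "measure ?M (B J) = (\<Prod>i\<in>I. measure P (if i \<in> J then A else space P - A))"
      unfolding B_def using A by (intro prob_times) auto
    also have "\<dots> = (\<Prod>i\<in>I. if i \<in> J then ?q else 1 - ?q)"
      by (intro prod.cong) (auto simp: Q.prob_compl A)
    also have "\<dots> = ?q ^ card J * (1 - ?q) ^ card (I - J)"
      using I by (simp add: prod.If_cases Int_absorb1 Diff_eq[symmetric] Int_commute)
    finally show "measure ?M (B J) = ?q ^ card J * (1 - ?q) ^ (card I - card J)"
      by (simp add: card_Diff_subset)
  qed
  also have "\<dots> = (\<Sum>j\<in>{k..card I}. \<Sum>J\<in>{J\<in>S. card J = j}. ?q ^ card J * (1 - ?q) ^ (card I - card J))"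
    using S I by (intro sum.group[symmetric]) (auto simp: S_def card_mono)
  also have "\<dots> = binom_tail (card I) k ?q"
    unfolding binom_tail_def
  proof (rule sum.cong[OF refl])
    fix j assume j: "j \<in> {k..card I}"
    then have "{J\<in>S. card J = j} = {J. J \<subseteq> I \<and> card J = j}" by (auto simp: S_def)
    then have "card {J\<in>S. card J = j} = card I choose j" using n_subsets[OF I] by simp
    then show "(\<Sum>J\<in>{J\<in>S. card J = j}. ?q ^ card J * (1 - ?q) ^ (card I - card J))
      = real (card I choose j) * ?q ^ j * (1 - ?q) ^ (card I - j)"
      by simp
  qed
  finally show ?thesis .
qed

section \<open>The law of the nearest-neighbour volume\<close>

lemma prob_space_density_prob_density:
  "prob_density p \<Longrightarrow> prob_space (density lborel (\<lambda>y. ennreal (p y)))"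
  unfolding prob_density_def by (intro prob_spaceI) (simp add: emeasure_density)

lemma prob_space_iid_samples: "prob_density p \<Longrightarrow> prob_space (iid_samples n p)"
  unfolding iid_samples_def by (intro prob_space_PiM prob_space_density_prob_density)

lemma sets_iid_samples [measurable_cong]:
  fixes p :: "real ^ 'd::finite \<Rightarrow> real"
  shows "sets (iid_samples n p) = sets (\<Pi>\<^sub>M i\<in>{..<n}. (borel :: (real ^ 'd) measure))"
  unfolding iid_samples_def by (intro sets_PiM_cong) auto

lemma measure_knn_volume_less:
  fixes x :: "real ^ 'd::finite"
  assumes p: "prob_density p" and k: "0 < k" "k \<le> n" and t: "0 \<le> t"
  shows "measure (iid_samples n p) {X \<in> space (iid_samples n p). knn_volume k n X x < t}
    = binom_tail n k (measure (density lborel (\<lambda>y. ennreal (p y))) (ball x (vol_radius TYPE('d) (t / real n))))"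
  using measure_PiM_card_ge[OF prob_space_density_prob_density[OF p],
      of "ball x (vol_radius TYPE('d) (t / real n))" "{..<n}" k] k t
  by (simp add: knn_volume_less_iff iid_samples_def)

text \<open>Points are null sets of Lebesgue measure, so almost surely no sample equals
  \<open>x\<close>; the open ball whose radius is the smallest sample distance is then free of
  samples.\<close>

lemma AE_knn_volume_pos:
  fixes x :: "real ^ 'd::finite"
  assumes p: "prob_density p" and k: "0 < k" "k \<le> n"
  shows "AE X in iid_samples n p. 0 < knn_volume k n X x"
proof -
  let ?P = "density lborel (\<lambda>y. ennreal (p y))"
  have "AE y in ?P. y \<noteq> x"
    using p AE_lborel_singleton[of x] unfolding prob_density_def by (subst AE_density) auto
  then have "AE X in iid_samples n p. X i \<noteq> x" if "i < n" for i
    unfolding iid_samples_def using that prob_space_density_prob_density[OF p]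
    by (intro AE_PiM_component) auto
  then have "AE X in iid_samples n p. \<forall>i\<in>{..<n}. X i \<noteq> x"
    by (intro AE_finite_allI) auto
  then show ?thesis
  proof eventually_elim
    case (elim X)
    define r where "r = Min ((\<lambda>i. dist x (X i)) ` {..<n})"
    have "0 < r" unfolding r_def using elim k by (subst Min_gr_iff) (auto simp: lessThan_empty_iff)
    have "r \<le> dist x (X i)" if "i < n" for i unfolding r_def using that by (intro Min_le) auto
    then have "{i \<in> {..<n}. X i \<in> ball x r} = {}" by (auto simp: not_less[symmetric])
    then have "\<not> knn_dist k n X x < r"
      unfolding knn_dist_less_iff[OF k] using k by (simp only: card.empty)
    with \<open>0 < r\<close> show ?case
      using k by (simp add: knn_volume_def content_ball_pos)
  qed
qed

section \<open>Mass of small balls under a Hoelder density\<close>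

text \<open>The counts sum to the length, which is therefore one. Hence the choice of directions in
  \<open>multi_partial\<close> is unique for a multi-index of order one.\<close>

lemma count_list_eq_single:
  fixes j :: "'d::finite"
  assumes "count_list js = (\<lambda>i. if i = j then 1 else 0)"
  shows "js = [j]"
proof -
  have "length js = sum (count_list js) UNIV" by (subst sum_count_set) auto
  also have "\<dots> = 1" unfolding assms by simp
  finally obtain i where "js = [i]" by (auto simp: length_Suc_conv)
  with fun_cong[OF assms, of j] show ?thesis by (auto split: if_splits)
qed

lemma multi_partial_single:
  fixes j :: "'d::finite"
  shows "multi_partial (\<lambda>i. if i = j then 1 else 0) h = partial_deriv j h"
proof -
  have "count_list [j] = (\<lambda>i. if i = j then 1 else 0)" by auto
  then have "(SOME js. count_list js = (\<lambda>i. if i = j then 1 else 0)) = [j]"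
    by (intro some_equality count_list_eq_single)
  then show ?thesis unfolding multi_partial_def by simp
qed

lemma multi_partial_zero: "multi_partial (\<lambda>i::'d::finite. 0) h = h"
proof -
  have "js = []" if "count_list js = (\<lambda>i::'d. 0)" for js
    using that by (cases js) (auto simp: fun_eq_iff split: if_splits)
  then have "(SOME js. count_list js = (\<lambda>i::'d. 0)) = []"
    by (intro some_equality) auto
  then show ?thesis unfolding multi_partial_def by simp
qed

text \<open>In this range \<open>\<kappa> = 0\<close>, and the only multi-index of order
  \<open>0\<close> gives \<open>h\<close> itself.\<close>

lemma holder_on_le_1:
  assumes "holder_on \<sigma> S \<Omega> h" "0 < \<sigma>" "\<sigma> \<le> 1" "y \<in> \<Omega>" "z \<in> \<Omega>"
  shows "\<bar>h y - h z\<bar> \<le> S * norm (y - z) powr \<sigma>"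
proof (cases "y = z")
  case False
  have "nat (\<lceil>\<sigma>\<rceil> - 1) = 0" using assms by (simp add: ceiling_le_iff)
  then show ?thesis
    using assms False unfolding holder_on_def Let_def by (auto simp: multi_partial_zero dest!: spec[of _ "\<lambda>_. 0"])
qed auto

text \<open>In this range \<open>\<kappa> = 1\<close>, so the regularity condition bears on the
  first partial derivatives with exponent \<open>\<sigma> - 1\<close>.\<close>

lemma holder_on_gt_1:
  assumes "holder_on \<sigma> S \<Omega> h" "1 < \<sigma>" "\<sigma> \<le> 2"
  shows "y \<in> \<Omega> \<Longrightarrow> z \<in> \<Omega> \<Longrightarrow> \<bar>partial_deriv j h y - partial_deriv j h z\<bar> \<le> S * norm (y - z) powr (\<sigma> - 1)"
    and "y \<in> \<Omega> \<Longrightarrow> ((\<lambda>t. h (y + t *\<^sub>R axis j 1)) has_field_derivative partial_deriv j h y) (at 0)"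
proof -
  have "\<lceil>\<sigma>\<rceil> = 2" using assms by (intro ceiling_unique) auto
  then have \<kappa>: "nat (\<lceil>\<sigma>\<rceil> - 1) = 1" by simp
  {
    assume *: "y \<in> \<Omega>" "z \<in> \<Omega>"
    have "(\<Sum>i\<in>UNIV. if i = j then 1 else 0) = (1::nat)" by simp
    then show "\<bar>partial_deriv j h y - partial_deriv j h z\<bar> \<le> S * norm (y - z) powr (\<sigma> - 1)"
      using assms(1) * unfolding holder_on_def \<kappa> Let_def multi_partial_single[symmetric]
      by (cases "y = z") auto
  }
  assume "y \<in> \<Omega>"
  then have "(\<lambda>t. h (y + t *\<^sub>R axis j 1)) field_differentiable at 0"
    using assms(1) unfolding holder_on_def \<kappa> Let_def cont_diff_on_def by (metis iter_partial.simps(1) less_one list.size(3))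
  then show "((\<lambda>t. h (y + t *\<^sub>R axis j 1)) has_field_derivative partial_deriv j h y) (at 0)"
    unfolding partial_deriv_def by (simp add: field_differentiable_derivI)
qed

definition restrict_vec :: "'d::finite set \<Rightarrow> real ^ 'd \<Rightarrow> real ^ 'd" where
  "restrict_vec I v = (\<chi> i. if i \<in> I then v $ i else 0)"

lemma norm_restrict_vec_add_le:
  assumes "j \<notin> I" "t \<in> closed_segment 0 (v $ j)"
  shows "norm (restrict_vec I v + t *\<^sub>R axis j 1) \<le> norm v"
proof (rule norm_le_componentwise_cart)
  fix i
  have "\<bar>t\<bar> \<le> \<bar>v $ j\<bar>" using assms(2) by (auto simp: closed_segment_eq_real_ivl split: if_splits)
  then show "norm ((restrict_vec I v + t *\<^sub>R axis j 1) $ i) \<le> norm (v $ i)"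
    using assms(1) by (auto simp: restrict_vec_def axis_def)
qed

text \<open>One moves from \<open>x\<close> to \<open>x + v\<close> one coordinate at a time, so that only the partial
  derivatives, not total differentiability, are needed.\<close>

lemma holder_on_taylor_restrict:
  fixes x v :: "real ^ 'd::finite"
  assumes h: "holder_on \<sigma> S \<Omega> h" and \<sigma>: "1 < \<sigma>" "\<sigma> \<le> 2" and S: "0 \<le> S"
    and ball: "cball x (norm v) \<subseteq> \<Omega>"
  shows "\<bar>h (x + restrict_vec I v) - h x - (\<Sum>i\<in>I. partial_deriv i h x * v $ i)\<bar>
    \<le> real (card I) * (S * norm v powr \<sigma>)"
  using finite[of I]
proof (induction I rule: finite_induct)
  case empty
  then show ?case by (simp add: restrict_vec_def zero_vec_def[symmetric])
next
  case (insert j I)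
  let ?z = "x + restrict_vec I v"
  \<comment> \<open>Subtracting the linear part along coordinate \<open>j\<close> leaves as
    derivative a difference of partial derivatives, to which the Hoelder bound applies.\<close>
  let ?f = "\<lambda>t. h (?z + t *\<^sub>R axis j 1) - partial_deriv j h x * t"
  have in_ball: "?z + t *\<^sub>R axis j 1 \<in> cball x (norm v)" if "t \<in> closed_segment 0 (v $ j)" for t
    using norm_restrict_vec_add_le[OF insert.hyps(2) that]
    by (metis add.assoc add_diff_cancel_left' dist_commute dist_norm mem_cball)
  have "\<bar>?f (v $ j) - ?f 0\<bar> \<le> S * norm v powr (\<sigma> - 1) * \<bar>v $ j - 0\<bar>"
    unfolding real_norm_def[symmetric]
  proof (rule field_differentiable_bound[of "closed_segment 0 (v $ j)"])
    fix t assume t: "t \<in> closed_segment 0 (v $ j)"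
    let ?y = "?z + t *\<^sub>R axis j 1"
    have y: "?y \<in> \<Omega>" using in_ball[OF t] ball by auto
    have x: "x \<in> \<Omega>" using ball by (force simp: subset_iff)
    have "((\<lambda>s. h (?y + s *\<^sub>R axis j 1)) has_field_derivative partial_deriv j h ?y) (at 0)"
      using holder_on_gt_1(2)[OF h \<sigma> y] .
    \<comment> \<open>The partial derivative at \<open>?y\<close> is a derivative at parameter
      \<open>0\<close>; a shift turns it into the derivative at \<open>t\<close> along the line
      through \<open>?z\<close>.\<close>
    then have "((\<lambda>s. h (?z + s *\<^sub>R axis j 1)) has_field_derivative partial_deriv j h ?y) (at (0 + t))"
      by (subst DERIV_shift) (simp add: algebra_simps)
    then have "((\<lambda>s. h (?z + s *\<^sub>R axis j 1)) has_field_derivative partial_deriv j h ?y) (at t)" by simp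
    from DERIV_diff[OF this DERIV_cmult_Id[of "partial_deriv j h x"]]
    show "(?f has_field_derivative partial_deriv j h ?y - partial_deriv j h x) (at t within closed_segment 0 (v $ j))"
      by (rule has_field_derivative_at_within)
    have "\<bar>partial_deriv j h ?y - partial_deriv j h x\<bar> \<le> S * norm (?y - x) powr (\<sigma> - 1)"
      by (rule holder_on_gt_1(1)[OF h \<sigma> y x])
    also have "\<dots> \<le> S * norm v powr (\<sigma> - 1)"
      using norm_restrict_vec_add_le[OF insert.hyps(2) t] S \<sigma>
      by (intro mult_left_mono powr_mono2) (auto simp: add.assoc)
    finally show "norm (partial_deriv j h ?y - partial_deriv j h x) \<le> S * norm v powr (\<sigma> - 1)"
      by simp
  qed auto
  also have "\<dots> \<le> S * norm v powr (\<sigma> - 1) * norm v"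
    using S component_le_norm_cart[of v j] by (intro mult_left_mono) auto
  also have "\<dots> = S * norm v powr \<sigma>"
    by (cases "v = 0") (auto simp: powr_diff)
  finally have 1: "\<bar>?f (v $ j) - ?f 0\<bar> \<le> S * norm v powr \<sigma>" .
  have "restrict_vec (insert j I) v = restrict_vec I v + (v $ j) *\<^sub>R axis j 1"
    using insert.hyps by (auto simp: restrict_vec_def axis_def vec_eq_iff)
  then have "h (x + restrict_vec (insert j I) v) - h x - (\<Sum>i\<in>insert j I. partial_deriv i h x * v $ i)
     = (?f (v $ j) - ?f 0) + (h ?z - h x - (\<Sum>i\<in>I. partial_deriv i h x * v $ i))"
    using insert.hyps by (simp add: add.assoc)
  then show ?case using 1 insert.IH insert.hyps by (simp add: algebra_simps)
qed

text \<open>One form for both regimes: \<open>g = 0\<close> and constant \<open>S\<close> when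
  \<open>\<sigma> \<le> 1\<close>, the gradient and constant \<open>d * S\<close> when
  \<open>\<sigma> > 1\<close>.\<close>

lemma locally_holder_at_expansion:
  fixes p :: "real ^ 'd::finite \<Rightarrow> real"
  assumes "locally_holder_at \<sigma> S p x" and \<sigma>: "0 < \<sigma>" "\<sigma> \<le> 2" and S: "0 < S"
  obtains C R g where "0 \<le> C" "0 < R"
    "\<And>v. norm v < R \<Longrightarrow> \<bar>p (x + v) - p x - g \<bullet> v\<bar> \<le> C * norm v powr \<sigma>"
proof -
  obtain \<Omega> where \<Omega>: "open \<Omega>" "x \<in> \<Omega>" "holder_on \<sigma> S \<Omega> p"
    using assms unfolding locally_holder_at_def by auto
  then obtain R where R: "0 < R" "ball x R \<subseteq> \<Omega>" by (meson openE)
  show ?thesis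
  proof (cases "\<sigma> \<le> 1")
    case True
    show ?thesis
    proof (rule that[of S R 0])
      fix v :: "real ^ 'd" assume "norm v < R"
      then have "x + v \<in> \<Omega>" using R by (auto simp: dist_norm)
      then show "\<bar>p (x + v) - p x - 0 \<bullet> v\<bar> \<le> S * norm v powr \<sigma>"
        using holder_on_le_1[OF \<Omega>(3) \<sigma>(1) True _ \<Omega>(2), of "x + v"] by simp
    qed (use S R in auto)
  next
    case False
    show ?thesis
    proof (rule that[of "real CARD('d) * S" R "\<chi> i. partial_deriv i p x"])
      fix v :: "real ^ 'd" assume v: "norm v < R"
      then have "cball x (norm v) \<subseteq> \<Omega>" using R by (auto simp: subset_iff)
      moreover have "restrict_vec UNIV v = v" by (simp add: restrict_vec_def vec_eq_iff)
      ultimately show "\<bar>p (x + v) - p x - (\<chi> i. partial_deriv i p x) \<bullet> v\<bar> \<le> real CARD('d) * S * norm v powr \<sigma>"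
        using holder_on_taylor_restrict[OF \<Omega>(3), of x v UNIV] False \<sigma> S
        by (simp add: inner_vec_def mult.assoc)
    qed (use S R in auto)
  qed
qed

section \<open>Integration of the local expansion over a ball\<close>

lemma borel_measurable_indicator_ball_inner:
  fixes x g :: "'a::euclidean_space"
  shows "(\<lambda>y. indicator (ball x r) y * (g \<bullet> (y - x)) :: real) \<in> borel_measurable borel"
  by (intro borel_measurable_times borel_measurable_indicator borel_measurable_continuous_onI continuous_intros) auto

text \<open>The point reflection \<open>y \<mapsto> 2 * x - y\<close> preserves Lebesgue measure and
  the ball but flips the sign of the integrand, so the integral equals its own negative.\<close>

lemma integral_ball_odd:
  fixes x g :: "'a::euclidean_space"
  shows "(\<integral>y. indicator (ball x r) y * (g \<bullet> (y - x)) \<partial>lborel) = 0"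
proof -
  let ?f = "\<lambda>y. indicator (ball x r) y * (g \<bullet> (y - x)) :: real"
  have "integral\<^sup>L lborel ?f = integral\<^sup>L (distr lborel borel (\<lambda>y. 2 *\<^sub>R x + (-1) *\<^sub>R y)) ?f"
    by (subst lborel_affine[of "-1" "2 *\<^sub>R x"]) (auto simp: density_1)
  also have "\<dots> = (\<integral>y. ?f (2 *\<^sub>R x + (-1) *\<^sub>R y) \<partial>lborel)"
    by (intro integral_distr borel_measurable_indicator_ball_inner)
      (auto intro!: borel_measurable_continuous_onI continuous_intros)
  also have "\<dots> = (\<integral>y. - ?f y \<partial>lborel)"
  proof (intro Bochner_Integration.integral_cong refl)
    fix y
    have "2 *\<^sub>R x + (-1) *\<^sub>R y \<in> ball x r \<longleftrightarrow> y \<in> ball x r"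
      by (simp add: dist_norm scaleR_2 algebra_simps norm_minus_commute)
    moreover have "2 *\<^sub>R x + (-1) *\<^sub>R y - x = - (y - x)" by (simp add: scaleR_2)
    ultimately show "?f (2 *\<^sub>R x + (-1) *\<^sub>R y) = - ?f y"
      by (simp add: indicator_def inner_diff_right)
  qed
  also have "\<dots> = - integral\<^sup>L lborel ?f" by (rule Bochner_Integration.integral_minus)
  finally show ?thesis by simp
qed

lemma ball_mass_approx:
  fixes p :: "real ^ 'd::finite \<Rightarrow> real"
  assumes p: "prob_density p" and loc: "locally_holder_at \<sigma> S p x"
    and \<sigma>: "0 < \<sigma>" "\<sigma> \<le> 2" and S: "0 < S"
  obtains C R where "0 \<le> C" "0 < R"
    "\<And>r. 0 \<le> r \<Longrightarrow> r \<le> R \<Longrightarrow> \<bar>measure (density lborel (\<lambda>y. ennreal (p y))) (ball x r) - p x * measure lborel (ball x r)\<bar>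
       \<le> C * r powr \<sigma> * measure lborel (ball x r)"
proof -
  obtain C R g where C: "0 \<le> C" and R: "0 < R"
    and exp: "\<And>v. norm v < R \<Longrightarrow> \<bar>p (x + v) - p x - g \<bullet> v\<bar> \<le> C * norm v powr \<sigma>"
    using locally_holder_at_expansion[OF loc \<sigma> S] by blast
  have [measurable]: "p \<in> borel_measurable borel" and pos: "\<And>y. 0 \<le> p y"
    using p by (auto simp: prob_density_def)
  have intp: "integrable lborel p"
    using p unfolding prob_density_def by (intro integrableI_nonneg) auto
  show ?thesis
  proof (rule that[OF C R])
    fix r assume r: "0 \<le> r" "r \<le> R"
    let ?B = "ball x r"
    have i1: "integrable lborel (\<lambda>y. indicator ?B y * p y)"
      using integrable_mult_indicator[OF _ intp, of ?B] by simp
    have fin: "emeasure lborel ?B < \<infinity>" by (rule emeasure_lborel_ball_finite)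
    have i2: "integrable lborel (indicator ?B :: _ \<Rightarrow> real)"
      by (rule integrable_real_indicator[OF _ fin]) auto
    have i3: "integrable lborel (\<lambda>y. indicator ?B y * (g \<bullet> (y - x)))"
    proof (rule Bochner_Integration.integrable_bound[OF integrable_mult_right[OF i2, of "norm g * r"]])
      show "AE y in lborel. norm (indicator ?B y * (g \<bullet> (y - x))) \<le> norm (norm g * r * indicator ?B y)"
      proof (intro AE_I2)
        fix y
        have "\<bar>g \<bullet> (y - x)\<bar> \<le> norm g * r" if "y \<in> ?B"
          using Cauchy_Schwarz_ineq2[of g "y - x"] that
          by (smt (verit) dist_commute dist_norm mem_ball mult_left_mono norm_ge_zero)
        then show "norm (indicator ?B y * (g \<bullet> (y - x))) \<le> norm (norm g * r * indicator ?B y)"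
          using r by (simp add: indicator_def)
      qed
    qed (use borel_measurable_indicator_ball_inner[of x r g] in auto)
    have split: "indicator ?B y * (p y - p x - g \<bullet> (y - x))
        = indicator ?B y * p y - p x * indicator ?B y - indicator ?B y * (g \<bullet> (y - x))" for y
      by (simp add: algebra_simps)
    have "measure (density lborel (\<lambda>y. ennreal (p y))) ?B = (\<integral>y. indicator ?B y \<partial>density lborel (\<lambda>y. ennreal (p y)))"
      by simp
    also have "\<dots> = (\<integral>y. indicator ?B y * p y \<partial>lborel)"
      by (subst integral_density) (auto simp: pos mult.commute intro!: borel_measurable_indicator)
    \<comment> \<open>The linear term is inserted free of charge, as its integral over the ball is
      \<open>0\<close>.\<close>
    finally have "measure (density lborel (\<lambda>y. ennreal (p y))) ?B - p x * measure lborel ?B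
        = (\<integral>y. indicator ?B y * p y \<partial>lborel) - p x * (\<integral>y. indicator ?B y \<partial>lborel)
          - (\<integral>y. indicator ?B y * (g \<bullet> (y - x)) \<partial>lborel)"
      unfolding integral_ball_odd by simp
    also have "\<dots> = (\<integral>y. indicator ?B y * (p y - p x - g \<bullet> (y - x)) \<partial>lborel)"
      unfolding split using i1 i2 i3 by simp
    also have "\<bar>\<dots>\<bar> \<le> (\<integral>y. C * r powr \<sigma> * indicator ?B y \<partial>lborel)"
    proof (rule integral_abs_bound[THEN order_trans], rule integral_mono)
      show "integrable lborel (\<lambda>y. \<bar>indicator ?B y * (p y - p x - g \<bullet> (y - x))\<bar>)"
        unfolding split using i1 i2 i3 by (intro integrable_abs) simp
      show "integrable lborel (\<lambda>y. C * r powr \<sigma> * indicator ?B y)"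
        using i2 by simp
      fix y
      show "\<bar>indicator ?B y * (p y - p x - g \<bullet> (y - x))\<bar> \<le> C * r powr \<sigma> * indicator ?B y"
      proof (cases "y \<in> ?B")
        case True
        then have n: "norm (y - x) < r" by (simp add: dist_norm norm_minus_commute)
        then have "\<bar>p (x + (y - x)) - p x - g \<bullet> (y - x)\<bar> \<le> C * norm (y - x) powr \<sigma>"
          using r by (intro exp) auto
        also have "\<dots> \<le> C * r powr \<sigma>" using n C \<sigma> by (intro mult_left_mono powr_mono2) auto
        finally show ?thesis using True by simp
      qed simp
    qed
    finally show "\<bar>measure (density lborel (\<lambda>y. ennreal (p y))) ?B - p x * measure lborel ?B\<bar>
       \<le> C * r powr \<sigma> * measure lborel ?B"
      by simp
  qed
qed

section \<open>Averages over independent blocks\<close>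

text \<open>Bias-variance decomposition: expanding the square of the sum over pairs, independence
  gives \<open>\<mu>\<^sup>2\<close> off the diagonal, so the error is exactly
  \<open>(s - \<mu>\<^sup>2) / m + (\<mu> - c)\<^sup>2\<close>.\<close>

lemma (in prob_space) mean_square_error_average:
  fixes Y :: "nat \<Rightarrow> 'a \<Rightarrow> real"
  assumes indep: "indep_vars (\<lambda>_. borel) Y {..<m}" and m: "0 < m"
    and int: "\<And>i. i < m \<Longrightarrow> integrable M (\<lambda>\<omega>. (Y i \<omega>)\<^sup>2)"
    and mean: "\<And>i. i < m \<Longrightarrow> expectation (Y i) = \<mu>"
    and sq: "\<And>i. i < m \<Longrightarrow> expectation (\<lambda>\<omega>. (Y i \<omega>)\<^sup>2) = s"
  shows "integrable M (\<lambda>\<omega>. (1 / real m * (\<Sum>i<m. Y i \<omega>) - c)\<^sup>2)"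
    and "expectation (\<lambda>\<omega>. (1 / real m * (\<Sum>i<m. Y i \<omega>) - c)\<^sup>2) \<le> s / real m + (\<mu> - c)\<^sup>2"
proof -
  have rv [measurable]: "random_variable borel (Y i)" if "i < m" for i
    using indep that by (auto simp: indep_vars_def)
  have intY: "integrable M (Y i)" if "i < m" for i
    using square_integrable_imp_integrable[OF rv int] that by blast
  have prod: "integrable M (\<lambda>\<omega>. Y i \<omega> * Y j \<omega>)" "expectation (\<lambda>\<omega>. Y i \<omega> * Y j \<omega>) = (if i = j then s else \<mu>\<^sup>2)"
    if "i < m" "j < m" for i j
  proof -
    have "integrable M (\<lambda>\<omega>. Y i \<omega> * Y j \<omega>) \<and> expectation (\<lambda>\<omega>. Y i \<omega> * Y j \<omega>) = (if i = j then s else \<mu>\<^sup>2)"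
    proof (cases "i = j")
      case True
      then show ?thesis using int sq that by (simp add: power2_eq_square)
    next
      case False
      have "indep_vars (\<lambda>_. borel) Y {i, j}" using that by (intro indep_vars_subset[OF indep]) auto
      then show ?thesis
        using indep_vars_lebesgue_integral[of "{i, j}" Y] indep_vars_integrable[of "{i, j}" Y]
          intY mean that False by (auto simp: power2_eq_square)
    qed
    then show "integrable M (\<lambda>\<omega>. Y i \<omega> * Y j \<omega>)" "expectation (\<lambda>\<omega>. Y i \<omega> * Y j \<omega>) = (if i = j then s else \<mu>\<^sup>2)"
      by auto
  qed
  define T where "T \<omega> = (\<Sum>i<m. Y i \<omega>)" for \<omega>
  have T2: "(T \<omega>)\<^sup>2 = (\<Sum>i<m. \<Sum>j<m. Y i \<omega> * Y j \<omega>)" for \<omega>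
    by (simp add: T_def power2_eq_square sum_product)
  have iT: "integrable M T" unfolding T_def using intY by (intro Bochner_Integration.integrable_sum) auto
  have iT2: "integrable M (\<lambda>\<omega>. (T \<omega>)\<^sup>2)" unfolding T2 using prod by (intro Bochner_Integration.integrable_sum) auto
  have ET: "expectation T = real m * \<mu>"
    unfolding T_def using intY mean by (subst Bochner_Integration.integral_sum) auto
  have "expectation (\<lambda>\<omega>. (T \<omega>)\<^sup>2) = (\<Sum>i<m. \<Sum>j<m. if i = j then s else \<mu>\<^sup>2)"
    unfolding T2 using prod
    by (subst Bochner_Integration.integral_sum, force intro: Bochner_Integration.integrable_sum)
      (auto intro!: sum.cong simp: Bochner_Integration.integral_sum)
  also have "\<dots> = (\<Sum>i<m. \<Sum>j<m. \<mu>\<^sup>2 + (if i = j then s - \<mu>\<^sup>2 else 0))"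
    by (intro sum.cong) auto
  also have "\<dots> = (real m)\<^sup>2 * \<mu>\<^sup>2 + real m * (s - \<mu>\<^sup>2)"
    by (simp add: sum.distrib power2_eq_square algebra_simps)
  finally have ET2: "expectation (\<lambda>\<omega>. (T \<omega>)\<^sup>2) = (real m)\<^sup>2 * \<mu>\<^sup>2 + real m * (s - \<mu>\<^sup>2)" .
  have eq: "(1 / real m * (\<Sum>i<m. Y i \<omega>) - c)\<^sup>2 = (T \<omega>)\<^sup>2 / (real m)\<^sup>2 - 2 * c / real m * T \<omega> + c\<^sup>2" for \<omega>
    using m by (simp add: T_def[symmetric] power2_eq_square field_simps)
  show "integrable M (\<lambda>\<omega>. (1 / real m * (\<Sum>i<m. Y i \<omega>) - c)\<^sup>2)"
    unfolding eq using iT iT2 by auto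
  have "expectation (\<lambda>\<omega>. (1 / real m * (\<Sum>i<m. Y i \<omega>) - c)\<^sup>2)
      = ((real m)\<^sup>2 * \<mu>\<^sup>2 + real m * (s - \<mu>\<^sup>2)) / (real m)\<^sup>2 - 2 * c / real m * (real m * \<mu>) + c\<^sup>2"
    unfolding eq using iT iT2 by (simp add: ET ET2 prob_space)
  also have "\<dots> = (s - \<mu>\<^sup>2) / real m + (\<mu> - c)\<^sup>2"
    using m by (simp add: power2_eq_square field_simps)
  also have "\<dots> \<le> s / real m + (\<mu> - c)\<^sup>2"
    using m by (simp add: divide_right_mono)
  finally show "expectation (\<lambda>\<omega>. (1 / real m * (\<Sum>i<m. Y i \<omega>) - c)\<^sup>2) \<le> s / real m + (\<mu> - c)\<^sup>2" .
qed

text \<open>Independence means that the joint law is the product of the marginal laws; for the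
  coordinates both are \<open>PiM I N\<close>.\<close>

lemma indep_vars_PiM_coordinate:
  assumes "\<And>i. i \<in> I \<Longrightarrow> prob_space (N i)" "I \<noteq> {}"
  shows "prob_space.indep_vars (PiM I N) N (\<lambda>i \<omega>. \<omega> i) I"
proof -
  interpret prob_space "PiM I N" using assms by (intro prob_space_PiM) auto
  have "distr (PiM I N) (PiM I N) (\<lambda>\<omega>. \<lambda>i\<in>I. \<omega> i) = PiM I N"
    using assms distr_PiM_reindex[of I N "\<lambda>i. i" I] by auto
  moreover have "PiM I (\<lambda>i. distr (PiM I N) (N i) (\<lambda>\<omega>. \<omega> i)) = PiM I N"
    using assms by (intro PiM_cong refl distr_PiM_component) auto
  ultimately show ?thesis
    using assms by (subst indep_vars_iff_distr_eq_PiM') auto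
qed

text \<open>Different blocks read disjoint sets of coordinates, which gives independence; the
  reindexing \<open>i \<mapsto> j * n + i\<close> is injective, which gives every block the law of
  \<open>n\<close> fresh samples.\<close>

lemma PiM_iid_blocks:
  fixes f :: "(nat \<Rightarrow> 'a) \<Rightarrow> real"
  assumes P: "prob_space P" and f [measurable]: "f \<in> borel_measurable (\<Pi>\<^sub>M i\<in>{..<n}. P)"
    and dep: "\<forall>X Y. (\<forall>i<n. X i = Y i) \<longrightarrow> f X = f Y" and m: "0 < m" and n: "0 < n"
  shows "prob_space.indep_vars (\<Pi>\<^sub>M i\<in>{..<m * n}. P) (\<lambda>_. borel) (\<lambda>j X. f (\<lambda>i. X (j * n + i))) {..<m}"
    and "j < m \<Longrightarrow> distr (\<Pi>\<^sub>M i\<in>{..<m * n}. P) borel (\<lambda>X. f (\<lambda>i. X (j * n + i))) = distr (\<Pi>\<^sub>M i\<in>{..<n}. P) borel f"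
proof -
  interpret prob_space "\<Pi>\<^sub>M i\<in>{..<m * n}. P" using P by (intro prob_space_PiM)
  have lt: "j * n + i < m * n" if "j < m" "i < n" for i j
  proof -
    have "j * n + i < Suc j * n" using that by simp
    also have "\<dots> \<le> m * n" using that by (intro mult_right_mono) auto
    finally show ?thesis .
  qed
  define K where "K j = (\<lambda>i. j * n + i) ` {..<n}" for j
  have K: "K j \<subseteq> {..<m * n}" if "j < m" for j using lt that by (auto simp: K_def)
  have disj: "disjoint_family_on K {..<m}"
  proof (unfold disjoint_family_on_def, intro ballI impI equals0I)
    fix j j' i assume "j \<noteq> j'" "i \<in> K j \<inter> K j'"
    have "i div n = j" if "i \<in> K j" for j using that by (auto simp: K_def)
    then have "i div n = j" "i div n = j'" using \<open>i \<in> K j \<inter> K j'\<close> by blast+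
    with \<open>j \<noteq> j'\<close> show False by simp
  qed
  have "indep_vars (\<lambda>_. P) (\<lambda>i \<omega>. \<omega> i) {..<m * n}"
    using P m n by (intro indep_vars_PiM_coordinate) (auto simp: lessThan_empty_iff)
  then have *: "indep_vars (\<lambda>j. \<Pi>\<^sub>M i\<in>K j. P) (\<lambda>j \<omega>. restrict (\<lambda>i. \<omega> i) (K j)) {..<m}"
    using K disj by (intro indep_vars_restrict) auto
  \<comment> \<open>Measurability of \<open>f\<close> concerns functions that are undefined outside
    \<open>{..<n}\<close>, whereas a shifted sample is not. By \<open>dep\<close> the restriction
    leaves the value of \<open>f\<close> unchanged.\<close>
  define g where "g j X = f (\<lambda>i\<in>{..<n}. X (j * n + i))" for j and X :: "nat \<Rightarrow> 'a"
  have g: "g j \<in> borel_measurable (\<Pi>\<^sub>M i\<in>K j. P)" for j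
  proof -
    have "(\<lambda>X. \<lambda>i\<in>{..<n}. X (j * n + i)) \<in> (\<Pi>\<^sub>M i\<in>K j. P) \<rightarrow>\<^sub>M (\<Pi>\<^sub>M i\<in>{..<n}. P)"
      by (intro measurable_restrict measurable_component_singleton) (auto simp: K_def)
    then show ?thesis unfolding g_def by measurable
  qed
  have "indep_vars (\<lambda>_. borel) (\<lambda>j \<omega>. g j (restrict (\<lambda>i. \<omega> i) (K j))) {..<m}"
    by (intro indep_vars_compose2[OF *] g)
  also have "(\<lambda>j \<omega>. g j (restrict (\<lambda>i. \<omega> i) (K j))) = (\<lambda>j X. f (\<lambda>i. X (j * n + i)))"
    unfolding g_def by (intro ext dep[rule_format]) (auto simp: K_def)
  finally show "indep_vars (\<lambda>_. borel) (\<lambda>j X. f (\<lambda>i. X (j * n + i))) {..<m}" .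
  assume j: "j < m"
  have h: "(\<lambda>X. \<lambda>i\<in>{..<n}. X (j * n + i)) \<in> (\<Pi>\<^sub>M i\<in>{..<m * n}. P) \<rightarrow>\<^sub>M (\<Pi>\<^sub>M i\<in>{..<n}. P)"
    using lt[OF j] by (intro measurable_restrict measurable_component_singleton) auto
  have "distr (\<Pi>\<^sub>M i\<in>{..<m * n}. P) borel (\<lambda>X. f (\<lambda>i. X (j * n + i)))
      = distr (\<Pi>\<^sub>M i\<in>{..<m * n}. P) borel (\<lambda>X. f (\<lambda>i\<in>{..<n}. X (j * n + i)))"
    by (intro distr_cong refl dep[rule_format]) auto
  also have "\<dots> = distr (distr (\<Pi>\<^sub>M i\<in>{..<m * n}. P) (\<Pi>\<^sub>M i\<in>{..<n}. P) (\<lambda>X. \<lambda>i\<in>{..<n}. X (j * n + i))) borel f"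
    using h by (subst distr_distr) (auto simp: comp_def)
  also have "distr (\<Pi>\<^sub>M i\<in>{..<m * n}. P) (\<Pi>\<^sub>M i\<in>{..<n}. P) (\<lambda>X. \<lambda>i\<in>{..<n}. X (j * n + i)) = (\<Pi>\<^sub>M i\<in>{..<n}. P)"
    using P lt[OF j] by (intro distr_PiM_reindex[where M="\<lambda>_. P"]) (auto simp: inj_on_def)
  finally show "distr (\<Pi>\<^sub>M i\<in>{..<m * n}. P) borel (\<lambda>X. f (\<lambda>i. X (j * n + i))) = distr (\<Pi>\<^sub>M i\<in>{..<n}. P) borel f" .
qed

section \<open>The mean square error\<close>

text \<open>Reparametrisation by volume: with \<open>r = (v / w) powr (1 / d)\<close>, the factor
  \<open>r powr \<sigma>\<close> becomes a constant times \<open>v powr (\<sigma> / d)\<close>, the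
  origin of the exponent \<open>\<sigma> / d\<close> in the rate.\<close>

lemma measure_density_ball_vol_radius_approx:
  fixes p :: "real ^ 'd::finite \<Rightarrow> real"
  assumes p: "prob_density p" and loc: "locally_holder_at \<sigma> S p x"
    and \<sigma>: "0 < \<sigma>" "\<sigma> \<le> 2" and S: "0 < S"
  obtains C v0 where "0 \<le> C" "0 < v0"
    "\<And>v. 0 \<le> v \<Longrightarrow> v \<le> v0 \<Longrightarrow>
       \<bar>measure (density lborel (\<lambda>y. ennreal (p y))) (ball x (vol_radius TYPE('d) v)) - p x * v\<bar>
       \<le> C * v powr (1 + \<sigma> / real CARD('d))"
proof -
  obtain C R where C: "0 \<le> C" and R: "0 < R" and
    approx: "\<And>r. 0 \<le> r \<Longrightarrow> r \<le> R \<Longrightarrow> \<bar>measure (density lborel (\<lambda>y. ennreal (p y))) (ball x r) - p x * measure lborel (ball x r)\<bar>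
       \<le> C * r powr \<sigma> * measure lborel (ball x r)"
    using ball_mass_approx[OF p loc \<sigma> S] by blast
  define w where "w = unit_ball_vol (real CARD('d))"
  have w: "0 < w" unfolding w_def by (rule unit_ball_vol_CARD_pos)
  show ?thesis
  proof (rule that[of "C * w powr (- (\<sigma> / real CARD('d)))" "w * R ^ CARD('d)"])
    fix v assume v: "0 \<le> v" "v \<le> w * R ^ CARD('d)"
    let ?r = "vol_radius TYPE('d) v"
    have r: "?r = root CARD('d) (v / w)" by (simp add: vol_radius_def w_def)
    have r0: "0 \<le> ?r" using v w by (simp add: r)
    have "?r \<le> root CARD('d) (R ^ CARD('d))"
      unfolding r using v w by (intro real_root_le_mono) (auto simp: divide_le_eq mult.commute)
    then have rR: "?r \<le> R" using R by (simp add: real_root_power_cancel)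
    have "?r powr \<sigma> = (v / w) powr (\<sigma> / real CARD('d))"
    proof (cases "v = 0")
      case False
      then show ?thesis
        using v w by (simp add: r root_powr_inverse powr_powr)
    qed (simp add: vol_radius_def)
    also have "\<dots> = w powr (- (\<sigma> / real CARD('d))) * v powr (\<sigma> / real CARD('d))"
      using v w by (simp add: powr_divide powr_minus_divide)
    finally have rp: "?r powr \<sigma> = w powr (- (\<sigma> / real CARD('d))) * v powr (\<sigma> / real CARD('d))" .
    have "\<bar>measure (density lborel (\<lambda>y. ennreal (p y))) (ball x ?r) - p x * v\<bar> \<le> C * ?r powr \<sigma> * v"
      using approx[OF r0 rR] v by (simp add: measure_ball_vol_radius)
    also have "\<dots> = C * w powr (- (\<sigma> / real CARD('d))) * v powr (1 + \<sigma> / real CARD('d))"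
      using v by (cases "v = 0") (auto simp: rp powr_add)
    finally show "\<bar>measure (density lborel (\<lambda>y. ennreal (p y))) (ball x ?r) - p x * v\<bar>
      \<le> C * w powr (- (\<sigma> / real CARD('d))) * v powr (1 + \<sigma> / real CARD('d))" .
  qed (use C w R in auto)
qed

lemma split_knn_density_mean_square_error:
  fixes p :: "real ^ 'd::finite \<Rightarrow> real" and x :: "real ^ 'd"
  assumes p: "prob_density p" and k: "3 \<le> k" "k \<le> n" and C: "0 \<le> C" and s: "0 \<le> s"
    and \<nu>: "1 \<le> \<nu>" "\<nu> \<le> real n" "(p x + C) * \<nu> \<le> real n"
    and approx: "\<And>v. 0 \<le> v \<Longrightarrow> v \<le> \<nu> / real n \<Longrightarrow>
       \<bar>measure (density lborel (\<lambda>y. ennreal (p y))) (ball x (vol_radius TYPE('d) v)) - p x * v\<bar>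
       \<le> C * v powr (1 + s)"
    and M: "1 \<le> M"
  shows "integrable (iid_samples (M * n) p) (\<lambda>X. (split_knn_density k 0 \<nu> M n X x - p x)\<^sup>2)"
    and "(\<integral>X. (split_knn_density k 0 \<nu> M n X x - p x)\<^sup>2 \<partial>iid_samples (M * n) p)
      \<le> 3 * (real k - 1)\<^sup>2 * (p x + C) ^ k * \<nu> ^ k / real M
        + (2 * (real k - 1) * C * (p x + C) ^ (k - 1) * \<nu> ^ k * \<nu> powr s * real n powr (- s)
           + p x * real k * (1 + p x * \<nu>) ^ k * exp (- (p x * \<nu> * real (n - k) / real n)))\<^sup>2"
proof -
  let ?P = "density lborel (\<lambda>y. ennreal (p y))"
  let ?Q = "iid_samples n p" and ?QM = "iid_samples (M * n) p"
  let ?f = "\<lambda>X. trunc_knn_density k 0 \<nu> n X x"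
  let ?V = "3 * (real k - 1)\<^sup>2 * (p x + C) ^ k * \<nu> ^ k"
  let ?b = "2 * (real k - 1) * C * (p x + C) ^ (k - 1) * \<nu> ^ k * \<nu> powr s * real n powr (- s)
           + p x * real k * (1 + p x * \<nu>) ^ k * exp (- (p x * \<nu> * real (n - k) / real n))"
  have k0: "0 < k" "0 < n" using k by auto
  interpret Q: prob_space ?Q using p by (rule prob_space_iid_samples)
  interpret QM: prob_space ?QM using p by (rule prob_space_iid_samples)
  have U: "(\<lambda>X. knn_volume k n X x) \<in> borel_measurable ?Q"
    using borel_measurable_knn_volume[OF k0(1) k(2), of x] by (simp cong: measurable_cong_sets add: sets_iid_samples)
  interpret Q: binom_tail_law ?Q "\<lambda>X. knn_volume k n X x" n k
    "\<lambda>t. measure ?P (ball x (vol_radius TYPE('d) (t / real n)))" "p x" C s \<nu>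
  proof unfold_locales
    show "0 \<le> p x" using p by (simp add: prob_density_def)
    show "AE X in ?Q. 0 < knn_volume k n X x" using p k0(1) k(2) by (rule AE_knn_volume_pos)
    fix t assume "0 < t" "t \<le> \<nu>"
    then show "measure ?Q {X \<in> space ?Q. knn_volume k n X x < t} =
       binom_tail n k (measure ?P (ball x (vol_radius TYPE('d) (t / real n))))"
      using p k0(1) k(2) by (intro measure_knn_volume_less) auto
    show "\<bar>measure ?P (ball x (vol_radius TYPE('d) (t / real n))) - p x * (t / real n)\<bar> \<le> C * (t / real n) powr (1 + s)"
      using \<open>0 < t\<close> \<open>t \<le> \<nu>\<close> k0 by (intro approx divide_right_mono) auto
  qed (use U k C s \<nu> in auto)
  have f [measurable]: "?f \<in> borel_measurable ?Q" unfolding trunc_knn_density_def using U by measurable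
  have dep: "\<forall>X Z. (\<forall>i<n. X i = Z i) \<longrightarrow> ?f X = ?f Z"
  proof (intro allI impI)
    fix X Z :: "nat \<Rightarrow> real ^ 'd" assume "\<forall>i<n. X i = Z i"
    then have "knn_dist k n X x = knn_dist k n Z x" by (intro knn_dist_cong) simp
    then show "?f X = ?f Z" by (simp add: trunc_knn_density_def knn_volume_def)
  qed
  have "0 < M" using M by simp
  note blocks = PiM_iid_blocks[OF prob_space_density_prob_density[OF p] f[unfolded iid_samples_def] dep \<open>0 < M\<close> k0(2),
      folded iid_samples_def]
  let ?Z = "\<lambda>j X. ?f (\<lambda>i. X (j * n + i))"
  have Zm: "?Z j \<in> borel_measurable ?QM" if "j < M" for j
    using blocks(1) that by (auto simp: QM.indep_vars_def)
  \<comment> \<open>Since a block has the same law as a sample of size \<open>n\<close>, its moments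
    are those computed in the one-block space.\<close>
  have distr_eq: "integrable ?QM (\<lambda>X. g (?Z j X)) \<longleftrightarrow> integrable ?Q (\<lambda>X. g (?f X))"
      "(\<integral>X. g (?Z j X) \<partial>?QM) = (\<integral>X. g (?f X) \<partial>?Q)"
    if "j < M" and [measurable]: "g \<in> borel_measurable borel" for j and g :: "real \<Rightarrow> real"
    using integrable_distr_eq[OF Zm[OF that(1)] that(2)] integrable_distr_eq[OF f that(2)]
      integral_distr[OF Zm[OF that(1)] that(2)] integral_distr[OF f that(2)] blocks(2)[OF that(1)]
    by auto
  have sq: "(\<lambda>y::real. y\<^sup>2) \<in> borel_measurable borel" by measurable
  note mse = QM.mean_square_error_average[OF blocks(1) \<open>0 < M\<close>, where \<mu>="Q.expectation ?f" and s="Q.expectation (\<lambda>X. (?f X)\<^sup>2)" and c="p x"]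
  have a1: "integrable ?QM (\<lambda>X. (?Z j X)\<^sup>2)" if "j < M" for j
    using distr_eq(1)[OF that sq] Q.second_moment(1) unfolding trunc_knn_density_def by blast
  have a2: "QM.expectation (?Z j) = Q.expectation ?f" if "j < M" for j
    using distr_eq(2)[OF that, of "\<lambda>y. y"] by simp
  have a3: "QM.expectation (\<lambda>X. (?Z j X)\<^sup>2) = Q.expectation (\<lambda>X. (?f X)\<^sup>2)" if "j < M" for j
    using distr_eq(2)[OF that sq] .
  show "integrable ?QM (\<lambda>X. (split_knn_density k 0 \<nu> M n X x - p x)\<^sup>2)"
    unfolding split_knn_density_def by (rule mse(1)[OF a1 a2 a3])
  have "QM.expectation (\<lambda>X. (split_knn_density k 0 \<nu> M n X x - p x)\<^sup>2)
     \<le> Q.expectation (\<lambda>X. (?f X)\<^sup>2) / real M + (Q.expectation ?f - p x)\<^sup>2"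
    unfolding split_knn_density_def by (rule mse(2)[OF a1 a2 a3])
  also have "\<dots> \<le> ?V / real M + ?b\<^sup>2"
  proof (intro add_mono divide_right_mono)
    show "Q.expectation (\<lambda>X. (?f X)\<^sup>2) \<le> ?V" unfolding trunc_knn_density_def by (rule Q.second_moment(2))
    have "\<bar>Q.expectation ?f - p x\<bar> \<le> ?b" unfolding trunc_knn_density_def by (rule Q.bias)
    then show "(Q.expectation ?f - p x)\<^sup>2 \<le> ?b\<^sup>2" by (rule power2_mono[OF order_trans[OF _ abs_ge_self]])
  qed simp
  finally show "QM.expectation (\<lambda>X. (split_knn_density k 0 \<nu> M n X x - p x)\<^sup>2) \<le> ?V / real M + ?b\<^sup>2" .
qed

text \<open>The exponent \<open>1 + \<epsilon>\<close> lies strictly above that of the logarithm,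
  and every polylogarithm is below every positive multiple of \<open>n\<close>. The three bounds
  serve in turn to make the truncation loss negligible, to keep the balls small, and to absorb
  powers of \<open>\<nu>\<close> into the soft O.\<close>

lemma eventually_truncation_level:
  fixes \<nu> :: "nat \<Rightarrow> real"
  assumes \<epsilon>: "0 < \<epsilon>" and pos: "\<forall>\<^sub>F n in sequentially. 0 < \<nu> n"
    and \<nu>: "\<nu> \<in> \<Theta>(\<lambda>n. ln (real n) powr (1 + \<epsilon>))"
  shows "\<forall>\<^sub>F n in sequentially. B * ln (real n) \<le> \<nu> n"
    and "0 < B \<Longrightarrow> \<forall>\<^sub>F n in sequentially. \<nu> n \<le> B * real n"
    and "\<exists>A a. 0 \<le> A \<and> (\<forall>\<^sub>F n in sequentially. \<nu> n \<le> A * ln (real n) ^ a)"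
proof -
  from \<nu> obtain c A where c: "0 < c" "\<forall>\<^sub>F n in sequentially. c * norm (ln (real n) powr (1 + \<epsilon>)) \<le> norm (\<nu> n)"
    and A: "0 < A" "\<forall>\<^sub>F n in sequentially. norm (\<nu> n) \<le> A * norm (ln (real n) powr (1 + \<epsilon>))"
    by (auto simp: bigtheta_def elim!: landau_o.bigE landau_omega.bigE)
  have "\<forall>\<^sub>F n in sequentially. B * ln (real n) \<le> c * ln (real n) powr (1 + \<epsilon>)"
    using c(1) \<epsilon> by real_asymp
  then show "\<forall>\<^sub>F n in sequentially. B * ln (real n) \<le> \<nu> n"
    using c(2) pos by eventually_elim auto
  show "\<forall>\<^sub>F n in sequentially. \<nu> n \<le> B * real n" if "0 < B"
  proof -
    have "\<forall>\<^sub>F n in sequentially. A * ln (real n) powr (1 + \<epsilon>) \<le> B * real n"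
      using A(1) that by real_asymp
    then show ?thesis using A(2) by eventually_elim auto
  qed
  have "\<forall>\<^sub>F n in sequentially. \<nu> n \<le> A * ln (real n) ^ nat \<lceil>1 + \<epsilon>\<rceil>"
    using A(2) eventually_ge_at_top[of 3]
  proof eventually_elim
    case (elim n)
    \<comment> \<open>From \<open>n \<ge> 3\<close> on the logarithm is at least \<open>1\<close>,
      so the real exponent may be rounded up to a natural number.\<close>
    have "1 \<le> ln (real n)"
      using elim(2) ln_ge_iff[of "real n" 1] exp_le by (simp add: order_trans[OF exp_le])
    then have "ln (real n) powr (1 + \<epsilon>) \<le> ln (real n) powr (real (nat \<lceil>1 + \<epsilon>\<rceil>))"
      by (intro powr_mono) linarith+
    also have "\<dots> = ln (real n) ^ nat \<lceil>1 + \<epsilon>\<rceil>"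
      using \<open>1 \<le> ln (real n)\<close> by (intro powr_realpow) auto
    finally have "A * ln (real n) powr (1 + \<epsilon>) \<le> A * ln (real n) ^ nat \<lceil>1 + \<epsilon>\<rceil>"
      using A(1) by simp
    then show ?case using elim(1) by auto
  qed
  then show "\<exists>A a. 0 \<le> A \<and> (\<forall>\<^sub>F n in sequentially. \<nu> n \<le> A * ln (real n) ^ a)"
    using A(1) by (intro exI[of _ A] exI[of _ "nat \<lceil>1 + \<epsilon>\<rceil>"]) auto
qed

theorem theorem12:
  fixes p :: "real ^ 'd::finite \<Rightarrow> real" and x :: "real ^ 'd"
    and \<sigma> S \<epsilon> :: real and k :: nat and \<nu> :: "nat \<Rightarrow> real"
  assumes "prob_density p"
    and "x \<in> supp p"
    and "0 < \<sigma>" and "\<sigma> \<le> 2" and "0 < S"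
    and "locally_holder_at \<sigma> S p x"
    and "3 \<le> k"
    and "0 < \<epsilon>"
    and "\<forall>\<^sub>F n in sequentially. 0 < \<nu> n"
    and "\<nu> \<in> \<Theta>(\<lambda>n. ln (real n) powr (1 + \<epsilon>))"
  defines "\<zeta> \<equiv> min (\<sigma> / real CARD('d)) 1"
  shows "(\<forall>\<^sub>F n in sequentially. \<forall>M\<ge>1.
            integrable (iid_samples (M * n) p)
              (\<lambda>X. (split_knn_density k 0 (\<nu> n) M n X x - p x)\<^sup>2)) \<and>
         (\<lambda>n M. \<integral>X. (split_knn_density k 0 (\<nu> n) M n X x - p x)\<^sup>2 \<partial>iid_samples (M * n) p)
           \<in> soft_O_unif (\<lambda>n M. real n powr (- 2 * \<zeta>) + 1 / real M)"
proof -
  let ?s = "\<sigma> / real CARD('d)"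
  let ?err = "\<lambda>n M. \<integral>X. (split_knn_density k 0 (\<nu> n) M n X x - p x)\<^sup>2 \<partial>iid_samples (M * n) p"
  let ?int = "\<lambda>n M. integrable (iid_samples (M * n) p) (\<lambda>X. (split_knn_density k 0 (\<nu> n) M n X x - p x)\<^sup>2)"
  let ?g = "\<lambda>n M. real n powr (- 2 * \<zeta>) + 1 / real M"
  obtain C v0 where C: "0 \<le> C" and v0: "0 < v0" and approx:
    "\<And>v. 0 \<le> v \<Longrightarrow> v \<le> v0 \<Longrightarrow>
       \<bar>measure (density lborel (\<lambda>y. ennreal (p y))) (ball x (vol_radius TYPE('d) v)) - p x * v\<bar>
       \<le> C * v powr (1 + ?s)"
    using measure_density_ball_vol_radius_approx[OF assms(1,6,3,4,5)] by blast
  have p0: "0 \<le> p x" using assms(1) by (simp add: prob_density_def)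
  have s: "0 \<le> ?s" "?s \<le> 2" "\<zeta> \<le> ?s" "\<zeta> \<le> 1"
  proof -
    have "?s \<le> \<sigma> / 1" using assms(3) by (intro divide_left_mono) (auto simp: Suc_le_eq)
    then show "?s \<le> 2" using assms(4) by simp
  qed (use assms(3) in \<open>auto simp: \<zeta>_def\<close>)
  note trunc = eventually_truncation_level[OF assms(8-10)]
  obtain A a where A: "0 \<le> A" "\<forall>\<^sub>F n in sequentially. \<nu> n \<le> A * ln (real n) ^ a"
    using trunc(3) by blast
  define K1 where "K1 = 3 * (real k - 1)\<^sup>2 * (p x + C) ^ k"
  define K2 where "K2 = 2 * (real k - 1) * C * (p x + C) ^ (k - 1) + p x * real k * (1 + p x) ^ k"
  \<comment> \<open>The power of \<open>\<nu>\<close> in the squared bias: \<open>k\<close> from the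
    bias bound and \<open>2\<close> from \<open>\<nu> n powr ?s\<close>, as
    \<open>?s \<le> 2\<close>, both doubled by squaring.\<close>
  define w where "w = 2 * (k + 2)"
  have K: "0 \<le> K1" "0 \<le> K2" using assms(7) C p0 by (auto simp: K1_def K2_def)
  \<comment> \<open>With \<open>\<nu> n \<le> B * n\<close> the three minima give
    \<open>\<nu> n \<le> n\<close>, \<open>(p x + C) * \<nu> n \<le> n\<close> and
    \<open>\<nu> n / n \<le> v0\<close>.\<close>
  define B where "B = min 1 (min (1 / (p x + C + 1)) v0)"
  have B: "0 < B" "B \<le> 1" "B * (p x + C) \<le> 1" "B \<le> v0"
  proof -
    have "B * (p x + C) \<le> 1 / (p x + C + 1) * (p x + C)"
      using p0 C by (intro mult_right_mono) (auto simp: B_def)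
    also have "\<dots> \<le> 1" using p0 C by simp
    finally show "B * (p x + C) \<le> 1" .
  qed (use p0 C v0 in \<open>auto simp: B_def\<close>)
  \<comment> \<open>For \<open>n \<ge> 2 * k\<close> the fraction \<open>(n - k) / n\<close> is at
    least \<open>1 / 2\<close>, so \<open>\<nu> n \<ge> (2 / p x) * ln n\<close> makes the
    exponential at most \<open>1 / n\<close>. For \<open>p x = 0\<close> the truncation term
    vanishes and \<open>0\<close> is a default.\<close>
  define L where "L = (if p x = 0 then 0 else 2 / p x)"
  \<comment> \<open>The quantifier over \<open>M\<close> stands inside the eventuality in
    \<open>n\<close>, which makes the threshold uniform in \<open>M\<close>.\<close>
  have "\<forall>\<^sub>F n in sequentially. \<forall>M\<ge>1. ?int n M \<and>
      ?err n M \<le> ((K1 + K2\<^sup>2) * A ^ w) * (ln (real n) ^ (a * w) * ?g n M)"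
    using trunc(1)[of 1] trunc(1)[of L] trunc(2)[OF B(1)] A(2) eventually_ge_at_top[of "max 3 (2 * k)"]
  proof eventually_elim
    case (elim n)
    have n: "3 \<le> n" "2 * k \<le> n" using elim(5) by auto
    have n0: "0 < real n" "1 \<le> real n" using n by auto
    have ln1: "1 \<le> ln (real n)"
      using n ln_ge_iff[of "real n" 1] by (simp add: order_trans[OF exp_le])
    have \<nu>1: "1 \<le> \<nu> n" using elim(1) ln1 by simp
    have \<nu>n: "\<nu> n \<le> real n"
      using elim(3) mult_right_mono[OF B(2), of "real n"] by simp
    have \<nu>c: "(p x + C) * \<nu> n \<le> real n"
    proof -
      have "(p x + C) * \<nu> n \<le> (p x + C) * (B * real n)"
        using elim(3) p0 C by (intro mult_left_mono) auto
      also have "\<dots> = (B * (p x + C)) * real n" by simp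
      also have "\<dots> \<le> 1 * real n" using B(3) by (intro mult_right_mono) auto
      finally show ?thesis by simp
    qed
    have \<nu>v: "\<nu> n / real n \<le> v0"
      using elim(3) B(4) n0 order_trans[of "\<nu> n / real n" B v0] by (simp add: divide_le_eq)
    have kn: "k \<le> n" using n by simp
    let ?b = "2 * (real k - 1) * C * (p x + C) ^ (k - 1) * \<nu> n ^ k * \<nu> n powr ?s * real n powr (- ?s)
           + p x * real k * (1 + p x * \<nu> n) ^ k * exp (- (p x * \<nu> n * real (n - k) / real n))"
    have "?b \<le> K2 * \<nu> n ^ (k + 2) * real n powr (- \<zeta>)"
    proof -
      have "\<nu> n powr ?s \<le> \<nu> n powr 2" using \<nu>1 s by (intro powr_mono) auto
      also have "\<dots> = \<nu> n ^ 2" using \<nu>1 powr_realpow[of "\<nu> n" 2] by simp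
      finally have "\<nu> n ^ k * \<nu> n powr ?s * real n powr (- ?s) \<le> \<nu> n ^ k * \<nu> n ^ 2 * real n powr (- \<zeta>)"
        using \<nu>1 n0 s by (intro mult_mono powr_mono) auto
      then have 1: "\<nu> n ^ k * \<nu> n powr ?s * real n powr (- ?s) \<le> \<nu> n ^ (k + 2) * real n powr (- \<zeta>)"
        by (simp only: power_add)
      have 2: "p x * (1 + p x * \<nu> n) ^ k * exp (- (p x * \<nu> n * real (n - k) / real n))
        \<le> p x * (1 + p x) ^ k * \<nu> n ^ (k + 2) * real n powr (- \<zeta>)"
      proof (cases "p x = 0")
        case False
        then have p: "0 < p x" using p0 by simp
        have "1 + p x * \<nu> n \<le> (1 + p x) * \<nu> n" using \<nu>1 by (simp add: distrib_right)
        then have "(1 + p x * \<nu> n) ^ k \<le> ((1 + p x) * \<nu> n) ^ k"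
          using p \<nu>1 by (intro power_mono) auto
        also have "\<dots> \<le> (1 + p x) ^ k * \<nu> n ^ (k + 2)"
          unfolding power_mult_distrib using p \<nu>1 by (intro mult_left_mono power_increasing) auto
        finally have 3: "(1 + p x * \<nu> n) ^ k \<le> (1 + p x) ^ k * \<nu> n ^ (k + 2)" .
        have half: "1 / 2 \<le> real (n - k) / real n" using n n0 by (simp add: field_simps of_nat_diff)
        then have "p x * \<nu> n * (1 / 2) \<le> p x * \<nu> n * (real (n - k) / real n)"
          using p \<nu>1 by (intro mult_left_mono[OF half]) auto
        moreover have "ln (real n) \<le> p x * \<nu> n * (1 / 2)"
          using elim(2) p by (simp add: L_def field_simps)
        ultimately have "ln (real n) \<le> p x * \<nu> n * (real (n - k) / real n)" by linarith
        then have "exp (- (p x * \<nu> n * real (n - k) / real n)) \<le> exp (- ln (real n))" by simp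
        also have "\<dots> = real n powr (- 1)" using n0 by (simp add: powr_def)
        \<comment> \<open>The truncation loss of order \<open>1 / n\<close> fits the rate because
          \<open>\<zeta> \<le> 1\<close>.\<close>
        also have "\<dots> \<le> real n powr (- \<zeta>)" using n0 s by (intro powr_mono) auto
        finally have 4: "exp (- (p x * \<nu> n * real (n - k) / real n)) \<le> real n powr (- \<zeta>)" .
        have "p x * ((1 + p x * \<nu> n) ^ k * exp (- (p x * \<nu> n * real (n - k) / real n)))
          \<le> p x * ((1 + p x) ^ k * \<nu> n ^ (k + 2) * real n powr (- \<zeta>))"
          using 3 4 p \<nu>1 by (intro mult_left_mono mult_mono) auto
        then show ?thesis by (simp only: mult.assoc)
      qed simp
      have "?b = (2 * (real k - 1) * C * (p x + C) ^ (k - 1)) * (\<nu> n ^ k * \<nu> n powr ?s * real n powr (- ?s))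
         + real k * (p x * (1 + p x * \<nu> n) ^ k * exp (- (p x * \<nu> n * real (n - k) / real n)))"
        by (simp only: mult_ac)
      also have "\<dots> \<le> (2 * (real k - 1) * C * (p x + C) ^ (k - 1)) * (\<nu> n ^ (k + 2) * real n powr (- \<zeta>))
         + real k * (p x * (1 + p x) ^ k * \<nu> n ^ (k + 2) * real n powr (- \<zeta>))"
        using 1 2 assms(7) C p0 by (intro add_mono mult_left_mono) auto
      also have "\<dots> = K2 * \<nu> n ^ (k + 2) * real n powr (- \<zeta>)"
        unfolding K2_def distrib_right by (simp only: mult_ac)
      finally show ?thesis .
    qed
    then have "?b\<^sup>2 \<le> (K2 * \<nu> n ^ (k + 2) * real n powr (- \<zeta>))\<^sup>2"
      using assms(7) C p0 \<nu>1 by (intro power_mono add_nonneg_nonneg mult_nonneg_nonneg) auto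
    also have "\<dots> = K2\<^sup>2 * \<nu> n ^ w * real n powr (- 2 * \<zeta>)"
    proof -
      have "(real n powr (- \<zeta>))\<^sup>2 = real n powr (- 2 * \<zeta>)"
        by (simp add: power2_eq_square flip: powr_add)
      moreover have "(\<nu> n ^ (k + 2))\<^sup>2 = \<nu> n ^ w"
        by (simp only: w_def power_mult[symmetric] mult.commute)
      ultimately show ?thesis by (simp only: power_mult_distrib)
    qed
    finally have b2: "?b\<^sup>2 \<le> K2\<^sup>2 * \<nu> n ^ w * real n powr (- 2 * \<zeta>)" .
    have \<nu>w: "\<nu> n ^ w \<le> A ^ w * ln (real n) ^ (a * w)"
      using power_mono[OF elim(4), of w] \<nu>1 by (simp add: power_mult_distrib power_mult)
    show ?case
    proof (intro allI impI)
      fix M :: nat assume M: "1 \<le> M"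
      note mse = split_knn_density_mean_square_error[OF assms(1,7) kn C s(1) \<nu>1 \<nu>n \<nu>c approx[OF _ order_trans[OF _ \<nu>v]] M]
      have "?err n M \<le> K1 * \<nu> n ^ k / real M + K2\<^sup>2 * \<nu> n ^ w * real n powr (- 2 * \<zeta>)"
        using mse(2) b2 unfolding K1_def by linarith
      \<comment> \<open>As \<open>\<nu> n \<ge> 1\<close> and \<open>k \<le> w\<close>, variance and
        squared bias can share the same power of \<open>\<nu> n\<close>.\<close>
      also have "K1 * \<nu> n ^ k / real M \<le> K1 * \<nu> n ^ w / real M"
        using K \<nu>1 by (intro divide_right_mono mult_left_mono power_increasing) (auto simp: w_def)
      also have "K1 * \<nu> n ^ w / real M + K2\<^sup>2 * \<nu> n ^ w * real n powr (- 2 * \<zeta>)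
        \<le> (K1 + K2\<^sup>2) * \<nu> n ^ w * ?g n M"
        using K \<nu>1 by (simp add: algebra_simps add_divide_distrib)
      also have "\<dots> \<le> (K1 + K2\<^sup>2) * (A ^ w * ln (real n) ^ (a * w)) * ?g n M"
        using K \<nu>w by (intro mult_right_mono mult_left_mono) auto
      finally have "?err n M \<le> ((K1 + K2\<^sup>2) * A ^ w) * (ln (real n) ^ (a * w) * ?g n M)"
        by (simp only: mult_ac)
      with mse(1) show "?int n M \<and> ?err n M \<le> ((K1 + K2\<^sup>2) * A ^ w) * (ln (real n) ^ (a * w) * ?g n M)"
        by blast
    qed
  qed
  note bound = this
  have "?err \<in> soft_O_unif ?g"
    unfolding soft_O_unif_def mem_Collect_eq
  \<comment> \<open>The added \<open>1\<close> makes the constant strictly positive, as the Landau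
    introduction rule demands.\<close>
  proof (intro exI[of _ "a * w"] landau_o.bigI[of "(K1 + K2\<^sup>2) * A ^ w + 1"])
    show "\<forall>\<^sub>F z in sequentially \<times>\<^sub>F principal {1..}.
      norm (case z of (n, M) \<Rightarrow> ?err n M)
        \<le> ((K1 + K2\<^sup>2) * A ^ w + 1) * norm (case z of (n, M) \<Rightarrow> ln (real n) ^ (a * w) * ?g n M)"
      unfolding eventually_prod_filter
    proof (intro exI conjI allI impI)
      show "\<forall>\<^sub>F n in sequentially. 1 \<le> n \<and> (\<forall>M\<ge>1. ?int n M \<and>
          ?err n M \<le> ((K1 + K2\<^sup>2) * A ^ w) * (ln (real n) ^ (a * w) * ?g n M))"
        using bound eventually_ge_at_top[of 1] by eventually_elim auto
      show "\<forall>\<^sub>F M in principal {1..}. 1 \<le> M" by (simp add: eventually_principal)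
      fix n M :: nat
      assume *: "1 \<le> n \<and> (\<forall>M\<ge>1. ?int n M \<and>
          ?err n M \<le> ((K1 + K2\<^sup>2) * A ^ w) * (ln (real n) ^ (a * w) * ?g n M))" and M: "1 \<le> M"
      let ?h = "ln (real n) ^ (a * w) * ?g n M"
      have h: "0 \<le> ?h" using * by (intro mult_nonneg_nonneg) auto
      have "?err n M \<le> ((K1 + K2\<^sup>2) * A ^ w) * ?h" using * M by blast
      also have "\<dots> \<le> ((K1 + K2\<^sup>2) * A ^ w + 1) * ?h" using h by (intro mult_right_mono) auto
      moreover have "0 \<le> ?err n M" by (intro integral_nonneg_AE AE_I2) auto
      ultimately show "norm (case (n, M) of (n, M) \<Rightarrow> ?err n M)
        \<le> ((K1 + K2\<^sup>2) * A ^ w + 1) * norm (case (n, M) of (n, M) \<Rightarrow> ln (real n) ^ (a * w) * ?g n M)"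
        using h by (simp only: prod.case real_norm_def abs_of_nonneg)
    qed
    have "0 \<le> (K1 + K2\<^sup>2) * A ^ w" using K A(1) by simp
    then show "0 < (K1 + K2\<^sup>2) * A ^ w + 1" by linarith
  qed
  moreover have "\<forall>\<^sub>F n in sequentially. \<forall>M\<ge>1. ?int n M"
    using bound by eventually_elim blast
  ultimately show ?thesis by blast
qed

end
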